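(* Let $\rho,\delta\in(0,1)$ and consider a sequence of triples of integers $(k_n,n,N_n)$, indexed by $n$, with $k_n<n<N_n$, $k_n/n\to\rho$ and $n/N_n\to\delta$ as $n\to\infty$. Write $k=k_n$, $N=N_n$. Let $A$ denote a uniformly distributed random orthogonal projection from $\mathbb{R}^{N}$ to $\mathbb{R}^n$, and let $H^N=[0,1]^N$ be the $N$-dimensional hypercube. Put $\rho_W(\delta;H^N):=\max(0,2-\delta^{-1})$. Then $$\lim_{n\to\infty}\frac{\mathcal{E}f_k(AH^N)}{f_k(H^N)}=\begin{cases}1,&\rho<\rho_W(\delta;H^N),\\ 0,&\rho>\rho_W(\delta;H^N).\end{cases}$$
   Context: For a polyhedron $Q$, $f_k(Q)$ denotes the number of $k$-dimensional faces of $Q$; $AQ$ is the image of $Q$ under $A$; $\mathcal{E}$ denotes expectation. A uniformly distributed random orthogonal projection $A$ from $\mathbb{R}^N$ to $\mathbb{R}^n$ is the $n\times N$ random matrix obtained by first applying a uniformly distributed (Haar) random rotation of $\mathbb{R}^N$ and then projecting on the first $n$ coordinates. *)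

theory Defs
  imports
    "HOL-Probability.Probability"
    "HOL-Analysis.Finite_Function_Topology"
    "Jordan_Normal_Form.Determinant"
begin

text \<open>
  The dimension \<open>N\<close> varies along the sequence, so the space of \<open>N\<close>-tuples is realised as the
  subspace of the real vector space \<^typ>\<open>nat \<Rightarrow>\<^sub>0 real\<close> consisting of the functions
  supported in \<open>{..<N}\<close>.  Coordinates, matrix rows and matrix columns are numbered from \<open>0\<close>.
\<close>

definition Rspace :: "nat \<Rightarrow> (nat \<Rightarrow>\<^sub>0 real) set" where
  "Rspace N = {x. Poly_Mapping.keys x \<subseteq> {..<N}}"

definition hypercube :: "nat \<Rightarrow> (nat \<Rightarrow>\<^sub>0 real) set" where
  "hypercube N = {x \<in> Rspace N. \<forall>i<N. 0 \<le> Poly_Mapping.lookup x i \<and> Poly_Mapping.lookup x i \<le> 1}"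

definition mat_map :: "real mat \<Rightarrow> (nat \<Rightarrow>\<^sub>0 real) \<Rightarrow> (nat \<Rightarrow>\<^sub>0 real)" where
  "mat_map A x = (\<Sum>i<dim_row A. Poly_Mapping.single i
                    (\<Sum>j<dim_col A. A $$ (i, j) * Poly_Mapping.lookup x j))"

text \<open>
  The library's \<open>aff_dim\<close> is restricted to Euclidean spaces; for a nonempty set we take the
  dimension of the direction space of its affine hull, which is spanned by the differences.
\<close>

definition set_dim :: "(nat \<Rightarrow>\<^sub>0 real) set \<Rightarrow> nat" where
  "set_dim S = dim {x - y | x y. x \<in> S \<and> y \<in> S}"

text \<open>\<open>num_faces k Q\<close> is $f_k(Q)$; the empty face has dimension \<open>-1\<close>, so it is excluded.\<close>

definition num_faces :: "nat \<Rightarrow> (nat \<Rightarrow>\<^sub>0 real) set \<Rightarrow> nat" where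
  "num_faces k Q = card {F. F face_of Q \<and> F \<noteq> {} \<and> set_dim F = k}"

definition rotations :: "nat \<Rightarrow> real mat set" where
  "rotations N = {R \<in> carrier_mat N N. R * transpose_mat R = 1\<^sub>m N \<and> Determinant.det R = 1}"

definition entries :: "nat \<Rightarrow> real mat \<Rightarrow> (nat \<times> nat \<Rightarrow> real)" where
  "entries N R = (\<lambda>p\<in>{..<N} \<times> {..<N}. R $$ p)"

abbreviation borel_entries :: "nat \<Rightarrow> (nat \<times> nat \<Rightarrow> real) measure" where
  "borel_entries N \<equiv> Pi\<^sub>M ({..<N} \<times> {..<N}) (\<lambda>_. borel)"

text \<open>
  A random element of the compact group of rotations is uniformly distributed if its law is the
  Haar probability measure, i.e. the Borel probability measure on that group which is invariant
  under left translations.  The law of a random matrix is taken on the space of its entries.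
\<close>

definition uniform_random_rotation :: "'w measure \<Rightarrow> nat \<Rightarrow> ('w \<Rightarrow> real mat) \<Rightarrow> bool" where
  "uniform_random_rotation M N U \<longleftrightarrow>
     prob_space M \<and>
     (\<forall>\<omega>\<in>space M. U \<omega> \<in> rotations N) \<and>
     (\<lambda>\<omega>. entries N (U \<omega>)) \<in> M \<rightarrow>\<^sub>M borel_entries N \<and>
     (\<forall>R\<in>rotations N.
        distr M (borel_entries N) (\<lambda>\<omega>. entries N (R * U \<omega>)) =
        distr M (borel_entries N) (\<lambda>\<omega>. entries N (U \<omega>)))"

definition first_coords :: "nat \<Rightarrow> nat \<Rightarrow> real mat" where
  "first_coords n N = Matrix.mat n N (\<lambda>(i, j). if i = j then 1 else 0)"

definition uniform_random_projection ::
    "'w measure \<Rightarrow> nat \<Rightarrow> nat \<Rightarrow> ('w \<Rightarrow> real mat) \<Rightarrow> bool" where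
  "uniform_random_projection M n N A \<longleftrightarrow>
     (\<exists>U. uniform_random_rotation M N U \<and> (\<forall>\<omega>\<in>space M. A \<omega> = first_coords n N * U \<omega>))"

definition rho_W_cube :: "real \<Rightarrow> real" where
  "rho_W_cube \<delta> = max 0 (2 - inverse \<delta>)"

end

(* A face of the cube is lost under a projection A iff the kernel of A meets the cone of feasible
   directions at that face outside the span of the face.  Fixing the k free coordinates, the 2^(N-k)
   faces with these free coordinates correspond to the orthants of R^(N-k), and for A in general
   position the (N-n)-dimensional kernel meets exactly 2 * sum_{l < N-n} C(N-k-1, l) of them.  Hence
   the ratio of the face counts is almost surely the constant
   1 - 2^-(N-k-1) * sum_{l < N-n} C(N-k-1, l), a binomial tail that tends to 1 or 0 according to
   whether (N-n)/(N-k) is asymptotically below or above 1/2.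
   General position of a uniform rotation follows from left invariance alone: rotating two rows by
   infinitely many angles makes the exceptional events disjoint, while they keep their probability. *)
theory Submission
  imports Defs
begin

text \<open>General position makes closed and open orthants equivalent for the kernel: a kernel
  vector on the boundary of an orthant can be pushed inside, so counting the orthants becomes
  counting the chambers of a hyperplane arrangement, by deletion and restriction. It also prevents
  cube faces of dimension above k from collapsing to images of dimension k. Singularity of a fixed
  minor is not by itself displaced by rotating two rows, so the null event is refined: the minor
  with one row and one column fewer is nonsingular, and exchanging the last row for a later row l
  makes the full minor nonsingular. Such an l exists because the rotation is invertible, and at most
  one angle modulo pi can put the rotated matrix into this event. The threshold is the point where
  (1 - \<delta>) / (1 - \<rho>\<delta>), the limit of (N-n)/(N-k), crosses 1/2, that is \<rho> = 2 -
  1/\<delta>. The maximum with 0 covers \<delta> < 1/2, where 2 - 1/\<delta> is negative and the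
  ratio tends to 0 for every \<rho> > 0.\<close>

section \<open>Sign patterns of generic functionals\<close>

text \<open>Up to d functionals are independent on W (in the form of dual vectors), and d of them
  separate the points of W. For finite I with at least d elements this forces W to have dimension d;
  the dual vectors are what the perturbation arguments consume.\<close>

definition generic_functionals ::
    "('i \<Rightarrow> 'v::real_vector \<Rightarrow> real) \<Rightarrow> 'v set \<Rightarrow> 'i set \<Rightarrow> nat \<Rightarrow> bool" where
  "generic_functionals \<phi> W I d \<longleftrightarrow>
     (\<forall>i. linear (\<phi> i)) \<and> subspace W \<and>
     (\<forall>J\<subseteq>I. card J \<le> d \<longrightarrow> (\<forall>j\<in>J. \<exists>u\<in>W. \<phi> j u = 1 \<and> (\<forall>i\<in>J - {j}. \<phi> i u = 0))) \<and>
     (\<forall>J\<subseteq>I. card J = d \<longrightarrow> (\<forall>u\<in>W. (\<forall>i\<in>J. \<phi> i u = 0) \<longrightarrow> u = 0))"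

lemma generic_functionals_dual:
  assumes "generic_functionals \<phi> W I d" "J \<subseteq> I" "card J \<le> d" "j \<in> J"
  obtains u where "u \<in> W" "\<phi> j u = 1" "\<And>i. i \<in> J \<Longrightarrow> i \<noteq> j \<Longrightarrow> \<phi> i u = 0"
proof -
  have "\<forall>J\<subseteq>I. card J \<le> d \<longrightarrow> (\<forall>j\<in>J. \<exists>u\<in>W. \<phi> j u = 1 \<and> (\<forall>i\<in>J - {j}. \<phi> i u = 0))"
    using assms(1) by (simp add: generic_functionals_def)
  then have "\<exists>u\<in>W. \<phi> j u = 1 \<and> (\<forall>i\<in>J - {j}. \<phi> i u = 0)"
    using assms(2-4) by simp
  then show ?thesis using that by auto
qed

lemma generic_functionals_unique:
  assumes "generic_functionals \<phi> W I d" "J \<subseteq> I" "card J = d" "u \<in> W" "\<And>i. i \<in> J \<Longrightarrow> \<phi> i u = 0"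
  shows "u = 0"
proof -
  have "\<forall>J\<subseteq>I. card J = d \<longrightarrow> (\<forall>u\<in>W. (\<forall>i\<in>J. \<phi> i u = 0) \<longrightarrow> u = 0)"
    using assms(1) by (simp add: generic_functionals_def)
  then show ?thesis using assms(2-5) by simp
qed

text \<open>A chamber of the arrangement of the hyperplanes \<phi> i = 0 in W is identified with the
  set P of functionals positive on it.\<close>

definition sign_patterns ::
    "('i \<Rightarrow> 'v::real_vector \<Rightarrow> real) \<Rightarrow> 'v set \<Rightarrow> 'i set \<Rightarrow> 'i set set" where
  "sign_patterns \<phi> W I =
     {P. P \<subseteq> I \<and> (\<exists>u\<in>W. (\<forall>i\<in>P. 0 < \<phi> i u) \<and> (\<forall>i\<in>I - P. \<phi> i u < 0))}"

text \<open>The number of chambers of a generic arrangement of \<open>m\<close> hyperplanes through the origin of a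
  \<open>d\<close>-dimensional space (Schlaefli's recursion: the new hyperplane cuts exactly the chambers that
  it meets).\<close>

fun chambers :: "nat \<Rightarrow> nat \<Rightarrow> nat" where
  "chambers 0 d = 1"
| "chambers (Suc m) 0 = 0"
| "chambers (Suc m) (Suc d) = chambers m (Suc d) + chambers m d"

text \<open>By Pascal's rule the partial row sums obey the recursion of \<open>chambers\<close>. The
  factor 2 reflects that chambers come in antipodal pairs, which requires at least one hyperplane;
  hence \<open>Suc m\<close>.\<close>

lemma chambers_eq_sum: "chambers (Suc m) d = 2 * (\<Sum>l<d. m choose l)"
proof (induction m arbitrary: d)
  case 0
  show ?case
  proof (cases d)
    case (Suc e)
    have "(\<Sum>l<Suc e. (0::nat) choose l) = 1"
      by (induction e) auto
    with Suc show ?thesis by simp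
  qed simp
next
  case (Suc m)
  show ?case
  proof (cases d)
    case d: (Suc e)
    have "chambers (Suc (Suc m)) d = 2 * ((\<Sum>l<Suc e. m choose l) + (\<Sum>l<e. m choose l))"
      using Suc.IH[of "Suc e"] Suc.IH[of e] d by simp
    also have "(\<Sum>l<Suc e. m choose l) + (\<Sum>l<e. m choose l) = (\<Sum>l<Suc e. Suc m choose l)"
      by (induction e) auto
    finally show ?thesis by (simp add: d)
  qed simp
qed

lemma finite_perturbation:
  fixes a b :: "'i \<Rightarrow> real"
  assumes "finite I"
  shows "\<exists>e>0. \<forall>i\<in>I. (0 < a i \<longrightarrow> 0 < a i + e * b i) \<and> (a i < 0 \<longrightarrow> a i + e * b i < 0)"
  using assms
proof (induction I)
  case empty
  then show ?case by (auto intro: exI[of _ 1])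
next
  case (insert i I)
  then obtain e where e: "e > 0"
    "\<forall>i\<in>I. (0 < a i \<longrightarrow> 0 < a i + e * b i) \<and> (a i < 0 \<longrightarrow> a i + e * b i < 0)" by auto
  \<comment> \<open>The value at r is a convex combination of the values at 0 and at s, so a step
    size that preserves signs may be decreased. This lets the induction take a minimum.\<close>
  have shrink: "(0 < a j \<longrightarrow> 0 < a j + r * b j) \<and> (a j < 0 \<longrightarrow> a j + r * b j < 0)"
    if "(0 < a j \<longrightarrow> 0 < a j + s * b j) \<and> (a j < 0 \<longrightarrow> a j + s * b j < 0)" "0 < r" "r \<le> s" for j r s
  proof -
    have *: "a j + r * b j = (1 - r/s) * a j + (r/s) * (a j + s * b j)"
      using that by (simp add: field_simps)
    define p where "p = r/s"
    have "0 \<le> 1 - p" "0 < p" using that by (auto simp: p_def)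
    then show ?thesis
      unfolding * p_def[symmetric] using that(1)
      by (auto intro!: add_nonneg_pos add_nonpos_neg mult_nonneg_nonneg mult_nonneg_nonpos mult_pos_neg mult_pos_pos
          simp del: mult_eq_0_iff)
  qed
  \<comment> \<open>The summand 1 in the denominator gives a strict bound and covers
    \<open>b i = 0\<close>.\<close>
  define d where "d = \<bar>a i\<bar> / (\<bar>b i\<bar> + 1)"
  have "\<exists>s>0. (0 < a i \<longrightarrow> 0 < a i + s * b i) \<and> (a i < 0 \<longrightarrow> a i + s * b i < 0)"
  proof (cases "a i = 0")
    case False
    have "\<bar>d * b i\<bar> < \<bar>a i\<bar>"
      using False by (simp add: d_def abs_mult field_simps)
    moreover have "d > 0" using False by (simp add: d_def)
    ultimately show ?thesis by (intro exI[of _ d]) linarith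
  qed (auto intro: exI[of _ 1])
  then obtain s where s: "s > 0" "(0 < a i \<longrightarrow> 0 < a i + s * b i) \<and> (a i < 0 \<longrightarrow> a i + s * b i < 0)"
    by auto
  show ?case
    using shrink[OF s(2), of "min e s"] shrink[where s = e and r = "min e s"] e s
    by (intro exI[of _ "min e s"]) auto
qed

lemma sign_perturbation:
  assumes "finite I" and lin: "\<And>i. linear (\<phi> i :: 'v::real_vector \<Rightarrow> real)"
  shows "\<exists>e>0. \<forall>i\<in>I. (0 < \<phi> i u \<longrightarrow> 0 < \<phi> i (u + e *\<^sub>R w)) \<and> (\<phi> i u < 0 \<longrightarrow> \<phi> i (u + e *\<^sub>R w) < 0)"
  using finite_perturbation[OF assms(1), of "\<lambda>i. \<phi> i u" "\<lambda>i. \<phi> i w"]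
  by (simp add: linear_add[OF lin] linear_scale[OF lin])

text \<open>A family J on the hyperplane is tested through \<open>insert i J\<close> on W: the dual
  vectors of that larger family for j in J vanish under \<phi> i, so they already lie in the
  slice.\<close>

lemma generic_functionals_slice:
  assumes g: "generic_functionals \<phi> W (insert i I) (Suc d)" and "finite I" "i \<notin> I"
  shows "generic_functionals \<phi> {u \<in> W. \<phi> i u = 0} I d"
  unfolding generic_functionals_def
proof (intro conjI allI impI ballI)
  show lin: "linear (\<phi> j)" for j using g by (auto simp: generic_functionals_def)
  have W: "subspace W" using g by (auto simp: generic_functionals_def)
  show "subspace {u \<in> W. \<phi> i u = 0}"
    using W linear_subspace_kernel[OF lin[of i]] subspace_inter[of W "{u. \<phi> i u = 0}"]
    by (simp add: Int_def)
  fix J assume J: "J \<subseteq> I"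
  then have fin: "finite J" and iJ: "i \<notin> J" using assms by (auto dest: finite_subset)
  {
    fix j assume j: "card J \<le> d" "j \<in> J"
    then have "insert i J \<subseteq> insert i I" "card (insert i J) \<le> Suc d" "j \<in> insert i J"
      using J fin iJ j by auto
    then obtain u where "u \<in> W" "\<phi> j u = 1" "\<And>l. l \<in> insert i J \<Longrightarrow> l \<noteq> j \<Longrightarrow> \<phi> l u = 0"
      using generic_functionals_dual[OF g] by metis
    with iJ j show "\<exists>u\<in>{u \<in> W. \<phi> i u = 0}. \<phi> j u = 1 \<and> (\<forall>i\<in>J - {j}. \<phi> i u = 0)"
      by (intro bexI[of _ u]) auto
  }
  {
    fix u assume u: "card J = d" "u \<in> {u \<in> W. \<phi> i u = 0}" "\<forall>i\<in>J. \<phi> i u = 0"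
    have "insert i J \<subseteq> insert i I" "card (insert i J) = Suc d"
      using J fin iJ u by auto
    with u show "u = 0"
      by (intro generic_functionals_unique[OF g]) auto
  }
qed

lemma generic_functionals_subset:
  assumes "generic_functionals \<phi> W I d" "J \<subseteq> I"
  shows "generic_functionals \<phi> W J d"
  unfolding generic_functionals_def
proof (intro conjI allI impI ballI)
  show "linear (\<phi> i)" "subspace W" for i
    using assms(1) by (auto simp: generic_functionals_def)
  fix K assume "K \<subseteq> J"
  then have K: "K \<subseteq> I" using assms(2) by simp
  show "\<exists>u\<in>W. \<phi> j u = 1 \<and> (\<forall>i\<in>K - {j}. \<phi> i u = 0)" if "card K \<le> d" "j \<in> K" for j
    using generic_functionals_dual[OF assms(1) K that] by (metis DiffE insertI1)
  show "u = 0" if "card K = d" "u \<in> W" "\<forall>i\<in>K. \<phi> i u = 0" for u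
    using generic_functionals_unique[OF assms(1) K that(1,2)] that(3) by blast
qed

text \<open>Deletion and restriction. Splitting by the sign of \<phi> i gives families X and Y of
  patterns on I; their union consists of the patterns on W, their intersection of those on the
  hyperplane \<phi> i = 0.\<close>

lemma card_sign_patterns:
  assumes "finite I" "generic_functionals \<phi> W I d"
  shows "card (sign_patterns \<phi> W I) = chambers (card I) d"
  using assms
proof (induction I arbitrary: W d rule: finite_induct)
  case empty
  then have "0 \<in> W" by (auto simp: generic_functionals_def subspace_0)
  then have "sign_patterns \<phi> W {} = {{}}" by (auto simp: sign_patterns_def)
  then show ?case by simp
next
  case (insert i I)
  then have lin: "linear (\<phi> j)" and W: "subspace W" for j
    by (auto simp: generic_functionals_def)
  note phi_simps = linear_add[OF lin] linear_diff[OF lin] linear_scale[OF lin]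
  have perturb: "\<exists>e>0. \<forall>j\<in>I. (0 < \<phi> j u \<longrightarrow> 0 < \<phi> j (u + e *\<^sub>R w)) \<and>
      (\<phi> j u < 0 \<longrightarrow> \<phi> j (u + e *\<^sub>R w) < 0)" for u w
    by (rule sign_perturbation[OF insert.hyps(1) lin])
  show ?case
  proof (cases d)
    case 0
    \<comment> \<open>With d = 0 the empty family already separates points, so W is trivial and no
      strict sign can be realised.\<close>
    then have "u = 0" if "u \<in> W" for u
      using insert.prems that unfolding generic_functionals_def
      by (metis card.empty empty_iff empty_subsetI)
    then have "\<phi> j u = 0" if "u \<in> W" for j u
      using that linear_0[OF lin] by metis
    then have "sign_patterns \<phi> W (insert i I) = {}"
      by (fastforce simp: sign_patterns_def)
    with 0 insert.hyps show ?thesis by simp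
  next
    case (Suc e)
    obtain w where w: "w \<in> W" "\<phi> i w = 1"
      using generic_functionals_dual[OF insert.prems, of "{i}" i] Suc by auto
    define R where "R = (\<lambda>V P. P \<subseteq> I \<and> (\<exists>u\<in>V. (\<forall>j\<in>P. 0 < \<phi> j u) \<and> (\<forall>j\<in>I - P. \<phi> j u < 0)))"
    define X where "X = {P. R {u\<in>W. \<phi> i u < 0} P}"
    define Y where "Y = {P. R {u\<in>W. \<phi> i u > 0} P}"
    have fin: "finite X" "finite Y"
      using insert.hyps by (auto simp: X_def Y_def R_def intro: finite_subset[of _ "Pow I"])
    have "sign_patterns \<phi> W (insert i I) = X \<union> insert i ` Y"
    proof (intro Set.set_eqI iffI)
      fix P assume P: "P \<in> sign_patterns \<phi> W (insert i I)"
      show "P \<in> X \<union> insert i ` Y"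
      proof (cases "i \<in> P")
        case True
        then have "P - {i} \<in> Y"
          using P insert.hyps by (fastforce simp: sign_patterns_def Y_def R_def)
        then show ?thesis using True by (auto intro!: image_eqI[of _ _ "P - {i}"])
      next
        case False
        then show ?thesis
          using P insert.hyps by (fastforce simp: sign_patterns_def X_def R_def)
      qed
    next
      fix P assume "P \<in> X \<union> insert i ` Y"
      then show "P \<in> sign_patterns \<phi> W (insert i I)"
        using insert.hyps by (fastforce simp: sign_patterns_def Y_def X_def R_def)
    qed
    moreover have "X \<inter> insert i ` Y = {}"
      using insert.hyps by (auto simp: X_def R_def)
    moreover have "inj_on (insert i) Y"
      using insert.hyps by (auto simp: inj_on_def Y_def R_def)
    ultimately have "card (sign_patterns \<phi> W (insert i I)) = card X + card Y"
      using fin by (simp add: card_Un_disjoint card_image)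
    also have "\<dots> = card (X \<union> Y) + card (X \<inter> Y)"
      using fin by (rule card_Un_Int)
    also have "X \<union> Y = sign_patterns \<phi> W I"
    proof (intro Set.set_eqI iffI)
      fix P assume P: "P \<in> sign_patterns \<phi> W I"
      then obtain u where u: "P \<subseteq> I" "u \<in> W" "\<forall>j\<in>P. 0 < \<phi> j u" "\<forall>j\<in>I - P. \<phi> j u < 0"
        by (auto simp: sign_patterns_def)
      consider "\<phi> i u < 0" | "0 < \<phi> i u" | "\<phi> i u = 0" by linarith
      then show "P \<in> X \<union> Y"
      proof cases
        case 3
        \<comment> \<open>A pattern realised on the hyperplane itself is pushed to the positive side
          along w.\<close>
        obtain e where e: "e > 0" "\<forall>j\<in>I. (0 < \<phi> j u \<longrightarrow> 0 < \<phi> j (u + e *\<^sub>R w)) \<and>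
            (\<phi> j u < 0 \<longrightarrow> \<phi> j (u + e *\<^sub>R w) < 0)"
          using perturb[of u w] by blast
        then have "u + e *\<^sub>R w \<in> {u \<in> W. \<phi> i u > 0}"
          using 3 u w W by (auto simp: phi_simps subspace_add subspace_scale)
        then have "R {u \<in> W. \<phi> i u > 0} P"
          unfolding R_def using u e(2) by (intro conjI bexI[of _ "u + e *\<^sub>R w"]) auto
        then show ?thesis by (simp add: Y_def)
      qed (use u in \<open>unfold X_def Y_def R_def, blast+\<close>)
    next
      fix P assume "P \<in> X \<union> Y"
      then show "P \<in> sign_patterns \<phi> W I"
        unfolding X_def Y_def R_def sign_patterns_def by blast
    qed
    also have "X \<inter> Y = sign_patterns \<phi> {u \<in> W. \<phi> i u = 0} I"
    proof (intro Set.set_eqI iffI)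
      fix P assume "P \<in> X \<inter> Y"
      then obtain x y where xy: "P \<subseteq> I" "x \<in> W" "\<phi> i x < 0" "y \<in> W" "\<phi> i y > 0"
          "\<forall>j\<in>P. 0 < \<phi> j x" "\<forall>j\<in>I - P. \<phi> j x < 0"
          "\<forall>j\<in>P. 0 < \<phi> j y" "\<forall>j\<in>I - P. \<phi> j y < 0"
        by (auto simp: X_def Y_def R_def)
      \<comment> \<open>Both coefficients are positive, so z keeps the signs common to x and y; they
        are chosen to cancel \<phi> i.\<close>
      define z where "z = \<phi> i y *\<^sub>R x + (- \<phi> i x) *\<^sub>R y"
      have "z \<in> {u \<in> W. \<phi> i u = 0}"
        using xy W by (simp add: z_def phi_simps subspace_add subspace_diff subspace_scale)
      have "\<phi> j z = \<phi> i y * \<phi> j x + (- \<phi> i x) * \<phi> j y" for j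
        unfolding z_def phi_simps by simp
      moreover have "0 < \<phi> i y * \<phi> j x" "\<phi> i x * \<phi> j y < 0" if "j \<in> P" for j
        using xy that by (simp_all add: mult_neg_pos)
      moreover have "\<phi> i y * \<phi> j x < 0" "0 < \<phi> i x * \<phi> j y" if "j \<in> I - P" for j
        using xy that by (simp_all add: mult_pos_neg mult_neg_neg)
      ultimately have "\<forall>j\<in>P. 0 < \<phi> j z" "\<forall>j\<in>I - P. \<phi> j z < 0"
        by force+
      with \<open>z \<in> _\<close> show "P \<in> sign_patterns \<phi> {u \<in> W. \<phi> i u = 0} I"
        using xy(1) unfolding sign_patterns_def by blast
    next
      fix P assume P: "P \<in> sign_patterns \<phi> {u \<in> W. \<phi> i u = 0} I"
      then obtain u where u: "P \<subseteq> I" "u \<in> W" "\<phi> i u = 0" "\<forall>j\<in>P. 0 < \<phi> j u" "\<forall>j\<in>I - P. \<phi> j u < 0"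
        by (auto simp: sign_patterns_def)
      obtain e where e: "e > 0" "\<forall>j\<in>I. (0 < \<phi> j u \<longrightarrow> 0 < \<phi> j (u + e *\<^sub>R w)) \<and>
          (\<phi> j u < 0 \<longrightarrow> \<phi> j (u + e *\<^sub>R w) < 0)"
        using perturb[of u w] by blast
      obtain f where f: "f > 0" "\<forall>j\<in>I. (0 < \<phi> j u \<longrightarrow> 0 < \<phi> j (u + f *\<^sub>R (- w))) \<and>
          (\<phi> j u < 0 \<longrightarrow> \<phi> j (u + f *\<^sub>R (- w)) < 0)"
        using perturb[of u "- w"] by blast
      have "u + e *\<^sub>R w \<in> {u \<in> W. \<phi> i u > 0}" "u + f *\<^sub>R (- w) \<in> {u \<in> W. \<phi> i u < 0}"
        using u(2,3) w W e(1) f(1)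
        by (auto simp: phi_simps linear_neg[OF lin] subspace_add subspace_diff subspace_neg subspace_scale)
      then have "R {u \<in> W. \<phi> i u > 0} P" "R {u \<in> W. \<phi> i u < 0} P"
        unfolding R_def using u(1,4,5) e(2) f(2) by blast+
      then show "P \<in> X \<inter> Y" by (simp add: X_def Y_def)
    qed
    also have "card (sign_patterns \<phi> W I) = chambers (card I) d"
      using insert.prems by (intro insert.IH) (auto intro: generic_functionals_subset)
    also have "card (sign_patterns \<phi> {u \<in> W. \<phi> i u = 0} I) = chambers (card I) e"
      using insert.prems insert.hyps unfolding Suc by (intro insert.IH generic_functionals_slice)
    finally show ?thesis using insert.hyps Suc by simp
  qed
qed

text \<open>A vector realising a pattern weakly vanishes on a set \<open>Z\<close> of fewer than \<open>d\<close> functionals,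
  and these can be given any prescribed signs by a small perturbation.\<close>

lemma weak_sign_patterns:
  assumes "finite I" "I \<noteq> {}" and g: "generic_functionals \<phi> W I d"
  shows "{P. P \<subseteq> I \<and> (\<exists>u\<in>W. (\<forall>i\<in>P. 0 \<le> \<phi> i u) \<and> (\<forall>i\<in>I - P. \<phi> i u \<le> 0) \<and> (\<exists>i\<in>I. \<phi> i u \<noteq> 0))}
         = sign_patterns \<phi> W I"
proof (intro Set.set_eqI iffI)
  fix P assume "P \<in> sign_patterns \<phi> W I"
  then obtain u where "P \<subseteq> I" "u \<in> W" "\<forall>i\<in>P. 0 < \<phi> i u" "\<forall>i\<in>I - P. \<phi> i u < 0"
    by (auto simp: sign_patterns_def)
  moreover from this obtain i where "i \<in> I" "\<phi> i u \<noteq> 0"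
    using \<open>I \<noteq> {}\<close> by (metis DiffI all_not_in_conv less_irrefl)
  ultimately show "P \<in> {P. P \<subseteq> I \<and> (\<exists>u\<in>W. (\<forall>i\<in>P. 0 \<le> \<phi> i u) \<and> (\<forall>i\<in>I - P. \<phi> i u \<le> 0) \<and>
      (\<exists>i\<in>I. \<phi> i u \<noteq> 0))}"
    by (auto intro!: bexI[of _ u] simp: less_imp_le)
next
  fix P assume "P \<in> {P. P \<subseteq> I \<and> (\<exists>u\<in>W. (\<forall>i\<in>P. 0 \<le> \<phi> i u) \<and> (\<forall>i\<in>I - P. \<phi> i u \<le> 0) \<and>
      (\<exists>i\<in>I. \<phi> i u \<noteq> 0))}"
  then obtain u where u: "P \<subseteq> I" "u \<in> W" "\<forall>i\<in>P. 0 \<le> \<phi> i u" "\<forall>i\<in>I - P. \<phi> i u \<le> 0"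
      "\<exists>i\<in>I. \<phi> i u \<noteq> 0" by auto
  have lin: "linear (\<phi> j)" and W: "subspace W" for j
    using g by (auto simp: generic_functionals_def)
  note phi_simps = linear_add[OF lin] linear_scale[OF lin] linear_sum[OF lin]
  define Z where "Z = {i\<in>I. \<phi> i u = 0}"
  have Z: "Z \<subseteq> I" "finite Z" using assms by (auto simp: Z_def)
  \<comment> \<open>Were d functionals zero at u, then u = 0, although some functional is nonzero
    there.\<close>
  have "card Z < d"
  proof (rule ccontr)
    assume "\<not> card Z < d"
    then have "d \<le> card Z" by simp
    then obtain J where J: "J \<subseteq> Z" "card J = d"
      by (rule obtain_subset_with_card_n)
    have "\<forall>i\<in>J. \<phi> i u = 0" "J \<subseteq> I" using J Z by (auto simp: Z_def)
    then have "u = 0"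
      using generic_functionals_unique[OF g] u(2) J(2) by blast
    then show False using u(5) linear_0[OF lin] by simp
  qed
  then have "\<forall>j\<in>Z. \<exists>v\<in>W. \<phi> j v = 1 \<and> (\<forall>i\<in>Z - {j}. \<phi> i v = 0)"
    using g Z(1) unfolding generic_functionals_def by simp
  then obtain v where v: "\<And>j. j \<in> Z \<Longrightarrow> v j \<in> W \<and> \<phi> j (v j) = 1 \<and> (\<forall>i\<in>Z - {j}. \<phi> i (v j) = 0)"
    by metis
  \<comment> \<open>By duality w takes the sign prescribed by P on every functional in Z, while a
    small multiple of w leaves the nonzero signs intact.\<close>
  define s where "s j = (if j \<in> P then 1 else -1 :: real)" for j
  define w where "w = (\<Sum>j\<in>Z. s j *\<^sub>R v j)"
  have wW: "w \<in> W" unfolding w_def using v W by (intro subspace_sum subspace_scale) auto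
  have phi_w: "\<phi> i w = s i" if "i \<in> Z" for i
  proof -
    have "\<phi> i w = (\<Sum>j\<in>Z. s j * \<phi> i (v j))"
      unfolding w_def phi_simps by simp
    also have "\<dots> = (\<Sum>j\<in>Z. if j = i then s i else 0)"
      using v that by (intro sum.cong) auto
    finally show ?thesis using Z that by simp
  qed
  obtain e where e: "e > 0" "\<forall>j\<in>I. (0 < \<phi> j u \<longrightarrow> 0 < \<phi> j (u + e *\<^sub>R w)) \<and>
      (\<phi> j u < 0 \<longrightarrow> \<phi> j (u + e *\<^sub>R w) < 0)"
    using sign_perturbation[OF assms(1), of \<phi> u w] lin by blast
  have Zval: "\<phi> i (u + e *\<^sub>R w) = e * s i" if "i \<in> Z" for i
    using that phi_w by (simp add: phi_simps Z_def)
  have "0 < \<phi> i (u + e *\<^sub>R w)" if "i \<in> P" for i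
  proof (cases "i \<in> Z")
    case False
    then have "0 < \<phi> i u" using that u(1,3) by (auto simp: Z_def less_le)
    then show ?thesis using e(2) u(1) that by blast
  qed (use that e(1) Zval[of i] in \<open>simp add: s_def\<close>)
  moreover have "\<phi> i (u + e *\<^sub>R w) < 0" if "i \<in> I - P" for i
  proof (cases "i \<in> Z")
    case False
    then have "\<phi> i u < 0" using that u(4) by (auto simp: Z_def less_le)
    then show ?thesis using e(2) that by blast
  qed (use that e(1) Zval[of i] in \<open>simp add: s_def\<close>)
  moreover have "u + e *\<^sub>R w \<in> W"
    using u(2) wW W by (intro subspace_add subspace_scale)
  ultimately show "P \<in> sign_patterns \<phi> W I"
    using u(1) unfolding sign_patterns_def by blast
qed

section \<open>Tails of the symmetric binomial distribution\<close>

text \<open>The variance m/4 of the symmetric binomial law, scaled by 2^m. Its weights are the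
  Bernstein polynomials at 1/2, whose moment identities yield the value.\<close>

lemma sum_choose_square:
  "(\<Sum>l\<le>m. (real l - real m / 2)\<^sup>2 * real (m choose l)) = real m / 4 * 2 ^ m"
proof -
  have "(\<Sum>l\<le>m. (real l - real m / 2)\<^sup>2 * Bernstein m l (1/2)) =
      (\<Sum>l\<le>m. real l * (real l - 1) * Bernstein m l (1/2)
        + ((1 - real m) * (real l * Bernstein m l (1/2)) + (real m / 2)\<^sup>2 * Bernstein m l (1/2)))"
    by (intro sum.cong) (auto simp: algebra_simps power2_eq_square)
  also have "\<dots> = real m / 4"
    unfolding sum.distrib sum_distrib_left[symmetric] sum_kk_Bernstein sum_k_Bernstein sum_Bernstein
    by (simp add: field_simps power2_eq_square)
  finally have "(\<Sum>l\<le>m. (real l - real m / 2)\<^sup>2 * Bernstein m l (1/2)) = real m / 4" .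
  moreover have "Bernstein m l (1/2) = real (m choose l) / 2 ^ m" if "l \<le> m" for l
    using that by (simp add: Bernstein_def power_divide power_add[symmetric])
  ultimately have "(\<Sum>l\<le>m. (real l - real m / 2)\<^sup>2 * real (m choose l)) / 2 ^ m = real m / 4"
    by (simp add: sum_divide_distrib)
  then show ?thesis by (simp add: field_simps)
qed

text \<open>Chebyshev's inequality for the symmetric binomial law.\<close>

lemma sum_choose_deviation:
  assumes A: "A \<subseteq> {..m}" and far: "\<And>l. l \<in> A \<Longrightarrow> \<bar>real l - real m / 2\<bar> \<ge> \<epsilon> * real m"
    and "\<epsilon> > 0" "m > 0"
  shows "(\<Sum>l\<in>A. real (m choose l)) / 2 ^ m \<le> 1 / (4 * \<epsilon>\<^sup>2 * real m)"
proof -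
  have "(\<epsilon> * real m)\<^sup>2 * (\<Sum>l\<in>A. real (m choose l)) \<le> (\<Sum>l\<in>A. (real l - real m / 2)\<^sup>2 * real (m choose l))"
    unfolding sum_distrib_left
  proof (rule sum_mono)
    fix l assume "l \<in> A"
    then have "(\<epsilon> * real m)\<^sup>2 \<le> (real l - real m / 2)\<^sup>2"
      using far[of l] assms by (intro abs_le_square_iff[THEN iffD1]) (auto simp: abs_mult)
    then show "(\<epsilon> * real m)\<^sup>2 * real (m choose l) \<le> (real l - real m / 2)\<^sup>2 * real (m choose l)"
      by (rule mult_right_mono) simp
  qed
  also have "\<dots> \<le> (\<Sum>l\<le>m. (real l - real m / 2)\<^sup>2 * real (m choose l))"
    using A by (intro sum_mono2) auto
  also have "\<dots> = real m / 4 * 2 ^ m" by (rule sum_choose_square)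
  finally show ?thesis
    using assms by (simp add: field_simps power2_eq_square)
qed

lemma sum_choose_below_tendsto_0:
  fixes m t :: "nat \<Rightarrow> nat"
  assumes m: "filterlim m at_top sequentially"
    and t: "(\<lambda>n. real (t n) / real (m n)) \<longlonglongrightarrow> \<beta>" and \<beta>: "\<beta> < 1/2"
  shows "(\<lambda>n. (\<Sum>l<t n. real (m n choose l)) / 2 ^ m n) \<longlonglongrightarrow> 0"
proof (rule tendsto_sandwich[OF _ _ tendsto_const])
  \<comment> \<open>Half of the gap: \<beta> + \<epsilon> = 1/2 - \<epsilon>, so eventually every
    index below \<open>t n\<close> is at distance at least \<epsilon> m from m/2.\<close>
  define \<epsilon> where "\<epsilon> = (1/2 - \<beta>) / 2"
  have \<epsilon>: "\<epsilon> > 0" using \<beta> by (simp add: \<epsilon>_def)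
  show "\<forall>\<^sub>F n in sequentially. 0 \<le> (\<Sum>l<t n. real (m n choose l)) / 2 ^ m n"
    by (simp add: sum_nonneg)
  have "\<forall>\<^sub>F n in sequentially. real (t n) / real (m n) < \<beta> + \<epsilon>"
    using t \<epsilon> by (intro order_tendstoD(2)[OF t]) simp
  moreover have "\<forall>\<^sub>F n in sequentially. m n > 0"
    using m[unfolded filterlim_at_top, rule_format, of 1] by (simp add: Suc_le_eq)
  ultimately show "\<forall>\<^sub>F n in sequentially.
      (\<Sum>l<t n. real (m n choose l)) / 2 ^ m n \<le> 1 / (4 * \<epsilon>\<^sup>2 * real (m n))"
  proof eventually_elim
    case (elim n)
    then have tn: "real (t n) < (1/2 - \<epsilon>) * real (m n)"
      by (simp add: \<epsilon>_def field_simps)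
    have "(1/2 - \<epsilon>) * real (m n) \<le> 1 * real (m n)"
      using \<epsilon> by (intro mult_right_mono) auto
    then have "t n \<le> m n" using tn by simp
    have far: "\<bar>real l - real (m n) / 2\<bar> \<ge> \<epsilon> * real (m n)" if "l \<in> {..<t n}" for l
    proof -
      have "real l < (1/2 - \<epsilon>) * real (m n)" using that tn by simp
      also have "\<dots> = real (m n) / 2 - \<epsilon> * real (m n)" by (simp add: left_diff_distrib)
      finally show ?thesis by simp
    qed
    show ?case
      by (rule sum_choose_deviation[OF _ far \<epsilon> elim(2)]) (use \<open>t n \<le> m n\<close> in auto)
  qed
  have "filterlim (\<lambda>n. real (m n)) at_top sequentially"
    using m by (rule filterlim_compose[OF filterlim_real_sequentially])
  then have "filterlim (\<lambda>n. (4 * \<epsilon>\<^sup>2) * real (m n)) at_top sequentially"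
    using \<epsilon> by (intro filterlim_tendsto_pos_mult_at_top[OF tendsto_const]) auto
  then show "(\<lambda>n. 1 / (4 * \<epsilon>\<^sup>2 * real (m n))) \<longlonglongrightarrow> 0"
    by (rule tendsto_divide_0[OF tendsto_const filterlim_at_top_imp_at_infinity])
qed

lemma sum_choose_below_tendsto_1:
  fixes m t :: "nat \<Rightarrow> nat"
  assumes m: "filterlim m at_top sequentially"
    and t: "(\<lambda>n. real (t n) / real (m n)) \<longlonglongrightarrow> \<beta>" and \<beta>: "\<beta> > 1/2"
    and le: "\<forall>\<^sub>F n in sequentially. t n \<le> m n"
  shows "(\<lambda>n. (\<Sum>l<t n. real (m n choose l)) / 2 ^ m n) \<longlonglongrightarrow> 1"
proof -
  \<comment> \<open>The complementary indices t, ..., m are mapped by l to m - l onto 0, ..., m - t;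
    there are m + 1 - t of them, and their proportion tends to 1 - \<beta> < 1/2.\<close>
  define s where "s n = Suc (m n) - t n" for n
  have pos: "\<forall>\<^sub>F n in sequentially. m n > 0"
    using m[unfolded filterlim_at_top, rule_format, of 1] by (simp add: Suc_le_eq)
  have real_m: "filterlim (\<lambda>n. real (m n)) at_top sequentially"
    using m by (rule filterlim_compose[OF filterlim_real_sequentially])
  have "(\<lambda>n. 1 + 1 / real (m n) - real (t n) / real (m n)) \<longlonglongrightarrow> 1 + 0 - \<beta>"
    by (intro tendsto_intros t tendsto_divide_0[OF tendsto_const]
          filterlim_at_top_imp_at_infinity real_m)
  moreover have "\<forall>\<^sub>F n in sequentially.
      1 + 1 / real (m n) - real (t n) / real (m n) = real (s n) / real (m n)"
    using le pos by eventually_elim (auto simp: s_def field_simps of_nat_diff)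
  ultimately have "(\<lambda>n. real (s n) / real (m n)) \<longlonglongrightarrow> 1 - \<beta>"
    by (simp add: tendsto_cong)
  then have "(\<lambda>n. 1 - (\<Sum>l<s n. real (m n choose l)) / 2 ^ m n) \<longlonglongrightarrow> 1 - 0"
    using \<beta> by (intro tendsto_diff tendsto_const sum_choose_below_tendsto_0[OF m]) auto
  moreover have "\<forall>\<^sub>F n in sequentially. 1 - (\<Sum>l<s n. real (m n choose l)) / 2 ^ m n
      = (\<Sum>l<t n. real (m n choose l)) / 2 ^ m n"
    using le
  proof eventually_elim
    case (elim n)
    have "(\<Sum>l<s n. real (m n choose l)) = (\<Sum>l\<in>{t n..m n}. real (m n choose l))"
      using elim
      by (intro sum.reindex_bij_witness[of _ "\<lambda>l. m n - l" "\<lambda>l. m n - l"])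
         (auto simp: s_def binomial_symmetric[symmetric])
    moreover have "{..m n} = {..<t n} \<union> {t n..m n}" using elim by auto
    then have "(\<Sum>l\<le>m n. real (m n choose l))
        = (\<Sum>l<t n. real (m n choose l)) + (\<Sum>l\<in>{t n..m n}. real (m n choose l))"
      by (simp add: sum.union_disjoint ivl_disj_int)
    moreover have "(\<Sum>l\<le>m n. real (m n choose l)) = 2 ^ m n"
      using choose_row_sum[of "m n"] by (metis of_nat_numeral of_nat_power of_nat_sum)
    ultimately have "(\<Sum>l<t n. real (m n choose l)) = 2 ^ m n - (\<Sum>l<s n. real (m n choose l))"
      by simp
    then show ?case by (simp add: diff_divide_distrib)
  qed
  ultimately show ?thesis by (simp add: tendsto_cong)
qed

section \<open>Faces of projected cubes\<close>

lemma lookup_scaleR [simp]: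
  "Poly_Mapping.lookup (r *\<^sub>R x) i = r * Poly_Mapping.lookup (x :: nat \<Rightarrow>\<^sub>0 real) i"
proof -
  have "finite {i. r * Poly_Mapping.lookup x i \<noteq> 0}"
    by (rule finite_subset[OF _ finite_lookup[of x]]) auto
  then show ?thesis by (simp add: scaleR_poly_mapping_def)
qed

lemma lookup_sum_single:
  "finite I \<Longrightarrow> Poly_Mapping.lookup (\<Sum>i\<in>I. Poly_Mapping.single i (f i)) j = (if j \<in> I then f j else (0::real))"
  by (simp add: lookup_sum lookup_single when_def sum.delta)

lemma lookup_mat_map:
  "Poly_Mapping.lookup (mat_map A x) i =
     (if i < dim_row A then \<Sum>j<dim_col A. A $$ (i, j) * Poly_Mapping.lookup x j else 0)"
  unfolding mat_map_def by (simp add: lookup_sum_single)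

lemma linear_mat_map: "linear (mat_map A)"
  by (intro linearI poly_mapping_eqI)
     (simp_all add: lookup_mat_map lookup_add algebra_simps sum.distrib sum_distrib_left)

lemma linear_lookup: "linear (\<lambda>x :: nat \<Rightarrow>\<^sub>0 real. Poly_Mapping.lookup x i)"
  by (intro linearI) (simp_all add: lookup_add)

lemma mat_map_eq_0_iff:
  "mat_map A x = 0 \<longleftrightarrow> (\<forall>i<dim_row A. (\<Sum>j<dim_col A. A $$ (i, j) * Poly_Mapping.lookup x j) = 0)"
  by (auto simp: poly_mapping_eq_iff fun_eq_iff lookup_mat_map)

lemma Rspace_iff: "x \<in> Rspace N \<longleftrightarrow> (\<forall>i\<ge>N. Poly_Mapping.lookup x i = 0)"
  by (auto simp: Rspace_def in_keys_iff) (meson in_keys_iff lessThan_iff not_le subsetD)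

lemma subspace_Rspace: "subspace (Rspace N)"
  by (auto simp: subspace_def Rspace_iff lookup_add)

lemma hypercube_iff:
  "x \<in> hypercube N \<longleftrightarrow> (\<forall>i. 0 \<le> Poly_Mapping.lookup x i \<and> Poly_Mapping.lookup x i \<le> 1) \<and>
     (\<forall>i\<ge>N. Poly_Mapping.lookup x i = 0)"
  unfolding hypercube_def mem_Collect_eq Rspace_iff
  by (metis not_le order_refl zero_le_one)

lemma convex_hypercube: "convex (hypercube N)"
  unfolding convex_alt
proof (intro ballI allI impI)
  fix x y and u :: real assume *: "x \<in> hypercube N" "y \<in> hypercube N" "0 \<le> u \<and> u \<le> 1"
  then have "(1 - u) * Poly_Mapping.lookup x i + u * Poly_Mapping.lookup y i \<le> 1" for i
    by (intro convex_bound_le) (auto simp: hypercube_iff)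
  with * show "(1 - u) *\<^sub>R x + u *\<^sub>R y \<in> hypercube N"
    by (auto simp: hypercube_iff lookup_add)
qed

section \<open>Faces of the cube\<close>

definition cube_face :: "nat \<Rightarrow> nat set \<Rightarrow> nat set \<Rightarrow> (nat \<Rightarrow>\<^sub>0 real) set" where
  "cube_face N S T = {x \<in> hypercube N. (\<forall>i\<in>S. Poly_Mapping.lookup x i = 0) \<and> (\<forall>i\<in>T. Poly_Mapping.lookup x i = 1)}"

text \<open>For disjoint S and T this is the midpoint of \<open>cube_face N S T\<close>: only the
  constraints of S and T are active, and every free coordinate has room 1/2 on both sides.\<close>

definition cube_center :: "nat \<Rightarrow> nat set \<Rightarrow> nat set \<Rightarrow> (nat \<Rightarrow>\<^sub>0 real)" where
  "cube_center N S T = (\<Sum>i<N. Poly_Mapping.single i (if i \<in> S then 0 else if i \<in> T then 1 else 1/2))"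

lemma lookup_cube_center:
  "Poly_Mapping.lookup (cube_center N S T) i =
     (if i < N then if i \<in> S then 0 else if i \<in> T then 1 else 1/2 else 0)"
  by (simp add: cube_center_def lookup_sum_single)

lemma cube_center_in_cube_face:
  "S \<union> T \<subseteq> {..<N} \<Longrightarrow> S \<inter> T = {} \<Longrightarrow> cube_center N S T \<in> cube_face N S T"
  by (auto simp: cube_face_def hypercube_iff lookup_cube_center)

lemma convex_cube_face: "convex (cube_face N S T)"
  using convex_hypercube[of N] unfolding convex_alt cube_face_def
  by (auto simp: lookup_add)

lemma convex_combination_eq_0:
  fixes x y u :: real
  assumes "0 < u" "u < 1" "0 \<le> x" "0 \<le> y" "(1 - u) * x + u * y = 0"
  shows "x = 0 \<and> y = 0"
  using assms by (smt (verit) mult_nonneg_nonneg mult_pos_pos)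

text \<open>0 and 1 are extreme in [0,1]: a proper convex combination attains one of them only if
  both ends do. The coordinates in T reduce to those in S by passing to 1 - x.\<close>

lemma cube_face_of_hypercube: "cube_face N S T face_of hypercube N"
  unfolding face_of_def
proof (intro conjI ballI impI convex_cube_face)
  show "cube_face N S T \<subseteq> hypercube N" by (auto simp: cube_face_def)
next
  fix a b x assume ab: "a \<in> hypercube N" "b \<in> hypercube N" "x \<in> cube_face N S T" "x \<in> open_segment a b"
  then obtain u where u: "0 < u" "u < 1" "x = (1 - u) *\<^sub>R a + u *\<^sub>R b"
    by (auto simp: in_segment)
  have comb: "Poly_Mapping.lookup x i = (1 - u) * Poly_Mapping.lookup a i + u * Poly_Mapping.lookup b i" for i
    by (simp add: u(3) lookup_add)
  have bounds: "0 \<le> Poly_Mapping.lookup a i" "Poly_Mapping.lookup a i \<le> 1"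
      "0 \<le> Poly_Mapping.lookup b i" "Poly_Mapping.lookup b i \<le> 1" for i
    using ab by (auto simp: hypercube_iff)
  have "Poly_Mapping.lookup a i = 0 \<and> Poly_Mapping.lookup b i = 0" if "i \<in> S" for i
    using that ab(3) bounds[of i] comb[of i] u
    by (intro convex_combination_eq_0[of u]) (auto simp: cube_face_def)
  moreover have "1 - Poly_Mapping.lookup a i = 0 \<and> 1 - Poly_Mapping.lookup b i = 0" if "i \<in> T" for i
  proof (rule convex_combination_eq_0[of u])
    have "Poly_Mapping.lookup x i = 1" using that ab(3) by (simp add: cube_face_def)
    then show "(1 - u) * (1 - Poly_Mapping.lookup a i) + u * (1 - Poly_Mapping.lookup b i) = 0"
      using comb[of i] by (simp add: algebra_simps)
  qed (use u bounds[of i] in auto)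
  ultimately show "a \<in> cube_face N S T" "b \<in> cube_face N S T"
    using ab by (auto simp: cube_face_def)
qed

text \<open>S and T collect the coordinates that are constantly 0 or 1 on F. Averaging gives a point
  c of F whose other coordinates are strictly between 0 and 1; every y of the cube face is then an
  end of a segment in the cube with c in its interior, so the face property puts y into F.\<close>

lemma face_of_hypercubeE:
  assumes F: "F face_of hypercube N" "F \<noteq> {}"
  obtains S T where "S \<union> T \<subseteq> {..<N}" "S \<inter> T = {}" "F = cube_face N S T"
proof
  define S where "S = {i. i < N \<and> (\<forall>x\<in>F. Poly_Mapping.lookup x i = 0)}"
  define T where "T = {i. i < N \<and> (\<forall>x\<in>F. Poly_Mapping.lookup x i = 1)}"
  show "S \<union> T \<subseteq> {..<N}" by (auto simp: S_def T_def)
  show "S \<inter> T = {}" using F(2) by (auto simp: S_def T_def)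
  have FH: "F \<subseteq> hypercube N" and "convex F"
    using F by (auto simp: face_of_def)
  then have mid: "(1/2) *\<^sub>R x + (1/2) *\<^sub>R y \<in> F" if "x \<in> F" "y \<in> F" for x y
    using that by (intro convexD) auto
  have free: "\<exists>x\<in>F. 0 < Poly_Mapping.lookup x i \<and> Poly_Mapping.lookup x i < 1"
    if "i < N" "i \<notin> S" "i \<notin> T" for i
  proof -
    have "\<exists>x\<in>F. Poly_Mapping.lookup x i \<noteq> 0" "\<exists>y\<in>F. Poly_Mapping.lookup y i \<noteq> 1"
      using that by (auto simp: S_def T_def)
    then obtain x y where "x \<in> F" "y \<in> F" "Poly_Mapping.lookup x i \<noteq> 0" "Poly_Mapping.lookup y i \<noteq> 1"
      by blast
    moreover from this have "0 < Poly_Mapping.lookup x i" "Poly_Mapping.lookup x i \<le> 1"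
        "Poly_Mapping.lookup y i < 1" "0 \<le> Poly_Mapping.lookup y i"
      using FH by (auto simp: hypercube_iff subset_iff less_le)
    ultimately show ?thesis
      by (intro bexI[OF _ mid[of x y]]) (auto simp: lookup_add)
  qed
  \<comment> \<open>A midpoint inherits strictness in a coordinate from either end, so the witnesses
    for single coordinates can be merged.\<close>
  have "\<exists>c\<in>F. \<forall>i\<in>J. 0 < Poly_Mapping.lookup c i \<and> Poly_Mapping.lookup c i < 1"
    if "finite J" "J \<subseteq> {..<N} - S - T" for J
    using that
  proof (induction J)
    case empty
    then show ?case using F(2) by auto
  next
    case (insert i J)
    then obtain c where c: "c \<in> F" "\<forall>i\<in>J. 0 < Poly_Mapping.lookup c i \<and> Poly_Mapping.lookup c i < 1"
      by auto
    obtain x where x: "x \<in> F" "0 < Poly_Mapping.lookup x i" "Poly_Mapping.lookup x i < 1"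
      using free[of i] insert.prems by auto
    have bounds: "0 \<le> Poly_Mapping.lookup c j" "Poly_Mapping.lookup c j \<le> 1"
        "0 \<le> Poly_Mapping.lookup x j" "Poly_Mapping.lookup x j \<le> 1" for j
      using c x FH by (auto simp: hypercube_iff subset_iff)
    show ?case
    proof (intro bexI[OF _ mid[OF c(1) x(1)]] ballI)
      fix j assume "j \<in> insert i J"
      then show "0 < Poly_Mapping.lookup ((1/2) *\<^sub>R c + (1/2) *\<^sub>R x) j \<and>
          Poly_Mapping.lookup ((1/2) *\<^sub>R c + (1/2) *\<^sub>R x) j < 1"
        using c(2) x(2,3) bounds[of j] by (auto simp: lookup_add dest!: bspec)
    qed
  qed
  from this[of "{..<N} - S - T"] obtain c
    where c: "c \<in> F" "\<And>i. i < N \<Longrightarrow> i \<notin> S \<Longrightarrow> i \<notin> T \<Longrightarrow> 0 < Poly_Mapping.lookup c i \<and> Poly_Mapping.lookup c i < 1"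
    by auto
  show "F = cube_face N S T"
  proof
    show "F \<subseteq> cube_face N S T"
      using FH by (auto simp: cube_face_def S_def T_def)
    show "cube_face N S T \<subseteq> F"
    proof
      fix y assume y: "y \<in> cube_face N S T"
      show "y \<in> F"
      proof (cases "y = c")
        case False
        text \<open>The segment from \<open>y\<close> through \<open>c\<close> can be prolonged inside the cube.\<close>
        obtain e where e: "e > 0" "\<forall>i\<in>{..<N}.
            (0 < Poly_Mapping.lookup c i \<longrightarrow>
               0 < Poly_Mapping.lookup c i + e * Poly_Mapping.lookup (c - y) i)"
          using finite_perturbation[of "{..<N}" "Poly_Mapping.lookup c" "Poly_Mapping.lookup (c - y)"] by auto
        obtain f where f: "f > 0" "\<forall>i\<in>{..<N}.
            (Poly_Mapping.lookup c i - 1 < 0 \<longrightarrow>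
               Poly_Mapping.lookup c i - 1 + f * Poly_Mapping.lookup (c - y) i < 0)"
          using finite_perturbation[of "{..<N}" "\<lambda>i. Poly_Mapping.lookup c i - 1" "Poly_Mapping.lookup (c - y)"] by auto
        define r where "r = min e f"
        have r: "r > 0" "r \<le> e" "r \<le> f" using e f by (auto simp: r_def)
        define z where "z = c + r *\<^sub>R (c - y)"
        have "0 \<le> Poly_Mapping.lookup z i \<and> Poly_Mapping.lookup z i \<le> 1" if "i < N" for i
        proof -
          have b: "0 \<le> Poly_Mapping.lookup c i" "Poly_Mapping.lookup c i \<le> 1"
            "0 \<le> Poly_Mapping.lookup y i" "Poly_Mapping.lookup y i \<le> 1"
            using c(1) y FH by (auto simp: hypercube_iff cube_face_def subset_iff)
          consider "i \<in> S" | "i \<in> T" | "i \<notin> S" "i \<notin> T" by blast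
          then show ?thesis
          proof cases
            case 3
            define d where "d = Poly_Mapping.lookup (c - y) i"
            have c01: "0 < Poly_Mapping.lookup c i" "Poly_Mapping.lookup c i < 1"
              using c(2) that 3 by auto
            have "0 < Poly_Mapping.lookup c i + e * d" "Poly_Mapping.lookup c i - 1 + f * d < 0"
              using c01 e f that by (auto simp: d_def)
            moreover have "e * d \<le> r * d" if "d \<le> 0"
              using r that by (intro mult_right_mono_neg) auto
            moreover have "r * d \<le> f * d" if "0 \<le> d"
              using r that by (intro mult_right_mono) auto
            moreover have "0 \<le> r * d" if "0 \<le> d" using r that by simp
            moreover have "r * d \<le> 0" if "d \<le> 0" using r that by (simp add: mult_nonneg_nonpos)
            moreover have "Poly_Mapping.lookup z i = Poly_Mapping.lookup c i + r * d"
              by (simp add: z_def d_def lookup_add)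
            ultimately show ?thesis using c01 by linarith
          qed (use c(1) y in \<open>auto simp: S_def T_def cube_face_def z_def lookup_add lookup_minus\<close>)
        qed
        moreover have "Poly_Mapping.lookup z i = 0" if "i \<ge> N" for i
          using that c(1) y FH by (auto simp: z_def lookup_add lookup_minus hypercube_iff cube_face_def subset_iff)
        ultimately have "z \<in> hypercube N"
          unfolding hypercube_iff by (metis not_le order_refl zero_le_one)
        \<comment> \<open>Since z - c = r (c - y), the point c divides the segment from y to z in
          the ratio 1 : r.\<close>
        moreover have "c = (1 - 1 / (1 + r)) *\<^sub>R y + (1 / (1 + r)) *\<^sub>R z"
        proof (rule poly_mapping_eqI)
          fix i
          define a b where "a = Poly_Mapping.lookup c i" and "b = Poly_Mapping.lookup y i"
          have "(1 - 1 / (1 + r)) * b + (1 / (1 + r)) * (a + r * (a - b)) = a"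
            using r by (simp add: divide_simps) (simp add: algebra_simps)
          then show "Poly_Mapping.lookup c i = Poly_Mapping.lookup ((1 - 1 / (1 + r)) *\<^sub>R y + (1 / (1 + r)) *\<^sub>R z) i"
            by (simp add: z_def lookup_add lookup_minus a_def b_def)
        qed
        moreover have "y \<noteq> z"
        proof
          assume "y = z"
          then have "(1 + r) *\<^sub>R (c - y) = 0" by (simp add: z_def algebra_simps)
          with False r show False by simp
        qed
        ultimately have "c \<in> open_segment y z"
          using r by (auto simp: in_segment intro!: exI[of _ "1 / (1 + r)"])
        moreover have "y \<in> hypercube N" using y by (simp add: cube_face_def)
        ultimately show ?thesis using F(1) c(1) \<open>z \<in> hypercube N\<close>
          by (auto simp: face_of_def)
      qed (use c in simp)
    qed
  qed
qed

text \<open>The faces of the projected cube are the images of the cube faces whose cone of feasible directions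
  meets the kernel of \<open>A\<close> only in directions along the face.\<close>

definition visible :: "real mat \<Rightarrow> nat set \<Rightarrow> nat set \<Rightarrow> bool" where
  "visible A S T \<longleftrightarrow> (\<forall>v\<in>Rspace (dim_col A). mat_map A v = 0 \<longrightarrow>
     (\<forall>i\<in>S. 0 \<le> Poly_Mapping.lookup v i) \<longrightarrow> (\<forall>i\<in>T. Poly_Mapping.lookup v i \<le> 0) \<longrightarrow>
     (\<forall>i\<in>S \<union> T. Poly_Mapping.lookup v i = 0))"

text \<open>q - w is a kernel vector in the cone of feasible directions at the face. A visible face
  is thus the full preimage of its image in the cube, so it can be recovered from that
  image.\<close>

lemma visible_preimage:
  assumes "dim_col A = N" "visible A S T" "w \<in> cube_face N S T" "q \<in> hypercube N" "mat_map A q = mat_map A w"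
  shows "q \<in> cube_face N S T"
proof -
  have "q - w \<in> Rspace (dim_col A)"
    using assms by (auto simp: cube_face_def hypercube_def subspace_diff[OF subspace_Rspace])
  moreover have "mat_map A (q - w) = 0"
    using assms by (simp add: linear_diff[OF linear_mat_map])
  moreover have "\<forall>i\<in>S. 0 \<le> Poly_Mapping.lookup (q - w) i" "\<forall>i\<in>T. Poly_Mapping.lookup (q - w) i \<le> 0"
    using assms by (auto simp: cube_face_def hypercube_iff lookup_minus)
  ultimately have "\<forall>i\<in>S \<union> T. Poly_Mapping.lookup (q - w) i = 0"
    using assms(2) unfolding visible_def by blast
  then show ?thesis
    using assms by (auto simp: cube_face_def lookup_minus)
qed

text \<open>A segment of the image is lifted to the cube; its lifted inner point lies in the cube
  face by \<open>visible_preimage\<close>, and there the face property of the cube applies.\<close>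

lemma visible_imp_face:
  assumes "dim_col A = N" "visible A S T"
  shows "mat_map A ` cube_face N S T face_of mat_map A ` hypercube N"
  unfolding face_of_def
proof (intro conjI ballI impI)
  show "mat_map A ` cube_face N S T \<subseteq> mat_map A ` hypercube N" by (auto simp: cube_face_def)
  show "convex (mat_map A ` cube_face N S T)"
    by (intro convex_linear_image linear_mat_map convex_cube_face)
  fix a b z
  assume "a \<in> mat_map A ` hypercube N" "b \<in> mat_map A ` hypercube N"
    "z \<in> mat_map A ` cube_face N S T" and seg: "z \<in> open_segment a b"
  then obtain x y w where xy: "x \<in> hypercube N" "y \<in> hypercube N" "w \<in> cube_face N S T"
    "a = mat_map A x" "b = mat_map A y" "z = mat_map A w" by auto
  obtain u where u: "0 < u" "u < 1" "z = (1 - u) *\<^sub>R a + u *\<^sub>R b"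
    using seg by (auto simp: in_segment)
  define q where "q = (1 - u) *\<^sub>R x + u *\<^sub>R y"
  have "q \<in> hypercube N"
    unfolding q_def using u xy convex_hypercube by (auto simp: convex_alt)
  moreover have "mat_map A q = mat_map A w"
    using u xy by (simp add: q_def linear_add[OF linear_mat_map] linear_scale[OF linear_mat_map])
  ultimately have q: "q \<in> cube_face N S T"
    using assms xy visible_preimage by blast
  have "x \<noteq> y" using seg xy by auto
  then have "q \<in> open_segment x y"
    using u by (auto simp: in_segment q_def)
  then have "x \<in> cube_face N S T \<and> y \<in> cube_face N S T"
    using face_ofD[OF cube_face_of_hypercube] xy q by blast
  then show "a \<in> mat_map A ` cube_face N S T" "b \<in> mat_map A ` cube_face N S T"
    using xy by auto
qed

text \<open>The preimage P of a face is a face of the cube. From its midpoint a small step along a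
  feasible kernel direction stays in the cube and does not change the image, so it stays in P; the
  direction therefore vanishes on the fixed coordinates.\<close>

lemma face_imp_visible:
  assumes dim: "dim_col A = N" and F: "F face_of mat_map A ` hypercube N" "F \<noteq> {}"
  obtains S T where "S \<union> T \<subseteq> {..<N}" "S \<inter> T = {}" "visible A S T" "F = mat_map A ` cube_face N S T"
proof -
  define P where "P = {x \<in> hypercube N. mat_map A x \<in> F}"
  have FA: "F \<subseteq> mat_map A ` hypercube N" using F by (auto simp: face_of_def)
  then have FP: "F = mat_map A ` P" by (auto simp: P_def)
  have "P face_of hypercube N"
    unfolding face_of_def
  proof (intro conjI ballI impI)
    show "P \<subseteq> hypercube N" by (auto simp: P_def)
    have "P = hypercube N \<inter> mat_map A -` F" by (auto simp: P_def)
    then show "convex P"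
      using F by (auto simp: face_of_def intro!: convex_Int convex_hypercube convex_linear_vimage linear_mat_map)
    fix a b x assume ab: "a \<in> hypercube N" "b \<in> hypercube N" "x \<in> P" "x \<in> open_segment a b"
    have "mat_map A a \<in> F \<and> mat_map A b \<in> F"
    \<comment> \<open>An open segment has distinct ends, so the case in which A collapses the
      segment to a point is separate.\<close>
    proof (cases "mat_map A a = mat_map A b")
      case True
      obtain u where "x = (1 - u) *\<^sub>R a + u *\<^sub>R b" using ab by (auto simp: in_segment)
      then have "mat_map A x = mat_map A a"
        using True by (simp add: linear_add[OF linear_mat_map] linear_scale[OF linear_mat_map]
            flip: scaleR_add_left)
      then show ?thesis using ab True by (simp add: P_def)
    next
      case False
      obtain u where "0 < u" "u < 1" "x = (1 - u) *\<^sub>R a + u *\<^sub>R b" using ab by (auto simp: in_segment)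
      then have "mat_map A x \<in> open_segment (mat_map A a) (mat_map A b)"
        using False by (auto simp: in_segment linear_add[OF linear_mat_map] linear_scale[OF linear_mat_map])
      then show ?thesis
        using face_ofD[OF F(1)] ab by (auto simp: P_def)
    qed
    then show "a \<in> P" "b \<in> P" using ab by (auto simp: P_def)
  qed
  moreover have "P \<noteq> {}" using F(2) FP by auto
  ultimately obtain S T where ST: "S \<union> T \<subseteq> {..<N}" "S \<inter> T = {}" "P = cube_face N S T"
    by (rule face_of_hypercubeE)
  have "visible A S T"
    unfolding visible_def
  proof (intro ballI impI)
    fix v i assume v: "v \<in> Rspace (dim_col A)" "mat_map A v = 0"
      "\<forall>i\<in>S. 0 \<le> Poly_Mapping.lookup v i" "\<forall>i\<in>T. Poly_Mapping.lookup v i \<le> 0" "i \<in> S \<union> T"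
    \<comment> \<open>m bounds all coordinates of v, and the summand 1 keeps it positive. Scaling by
      1/(2m) moves no coordinate by more than 1/2, the room available at the midpoint.\<close>
    define m where "m = 1 + (\<Sum>j<N. \<bar>Poly_Mapping.lookup v j\<bar>)"
    have vm: "\<bar>Poly_Mapping.lookup v j\<bar> \<le> m" if "j < N" for j
      unfolding m_def using member_le_sum[of j "{..<N}" "\<lambda>j. \<bar>Poly_Mapping.lookup v j\<bar>"] that by simp
    have m: "m > 0" by (simp add: m_def add_pos_nonneg sum_nonneg)
    define e where "e = 1 / (2 * m)"
    have e: "e > 0" using m by (simp add: e_def)
    have ve: "\<bar>e * Poly_Mapping.lookup v j\<bar> \<le> 1/2" if "j < N" for j
      using vm[OF that] m by (simp add: e_def field_simps)
    define x where "x = cube_center N S T + e *\<^sub>R v"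
    have "x \<in> hypercube N"
      unfolding hypercube_iff
    proof (intro conjI allI impI)
      fix j
      have "0 \<le> Poly_Mapping.lookup x j \<and> Poly_Mapping.lookup x j \<le> 1"
      proof (cases "j < N")
        case True
        consider "j \<in> S" | "j \<in> T" "j \<notin> S" | "j \<notin> S" "j \<notin> T" by blast
        then show ?thesis
        proof cases
          case 1
          then have "0 \<le> e * Poly_Mapping.lookup v j" using v e by simp
          then show ?thesis using 1 True ve[of j] by (simp add: x_def lookup_add lookup_cube_center)
        next
          case 2
          then have "e * Poly_Mapping.lookup v j \<le> 0" using v e by (simp add: mult_nonneg_nonpos)
          then show ?thesis using 2 True ve[of j] by (simp add: x_def lookup_add lookup_cube_center)
        next
          case 3
          then show ?thesis using True ve[of j, unfolded abs_le_iff] by (simp add: x_def lookup_add lookup_cube_center)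
        qed
      next
        case False
        then show ?thesis using v dim by (simp add: x_def lookup_add lookup_cube_center Rspace_iff)
      qed
      then show "0 \<le> Poly_Mapping.lookup x j" "Poly_Mapping.lookup x j \<le> 1" by auto
    next
      fix j assume "N \<le> j"
      then show "Poly_Mapping.lookup x j = 0"
        using v dim by (simp add: x_def lookup_add lookup_cube_center Rspace_iff)
    qed
    moreover have "mat_map A x = mat_map A (cube_center N S T)"
      using v by (simp add: x_def linear_add[OF linear_mat_map] linear_scale[OF linear_mat_map])
    moreover have "cube_center N S T \<in> P"
      using cube_center_in_cube_face ST by metis
    ultimately have "x \<in> cube_face N S T" "cube_center N S T \<in> cube_face N S T"
      unfolding ST(3)[symmetric] by (auto simp: P_def)
    then have "e * Poly_Mapping.lookup v i = 0"
      using v(5) by (auto simp: cube_face_def x_def lookup_add)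
    then show "Poly_Mapping.lookup v i = 0" using e by simp
  qed
  then show ?thesis using that ST FP by blast
qed

text \<open>Equal images give equal cube faces by \<open>visible_preimage\<close>, and the midpoint
  of a cube face reveals S and T as its coordinates equal to 0 and 1.\<close>

lemma inj_on_visible_faces:
  assumes "dim_col A = N"
  shows "inj_on (\<lambda>(S, T). mat_map A ` cube_face N S T)
    {(S, T). S \<union> T \<subseteq> {..<N} \<and> S \<inter> T = {} \<and> visible A S T}"
proof -
  have sub: "cube_face N S T \<subseteq> cube_face N S' T'"
    if vis: "visible A S' T'" and img: "mat_map A ` cube_face N S T = mat_map A ` cube_face N S' T'" for S T S' T'
  proof
    fix x assume x: "x \<in> cube_face N S T"
    then obtain w where "w \<in> cube_face N S' T'" "mat_map A x = mat_map A w"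
      using img by blast
    moreover have "x \<in> hypercube N" using x by (simp add: cube_face_def)
    ultimately show "x \<in> cube_face N S' T'"
      using visible_preimage[OF assms vis] by blast
  qed
  have ST: "S' \<subseteq> S \<and> T' \<subseteq> T"
    if ST: "S \<union> T \<subseteq> {..<N}" "S \<inter> T = {}" and ST': "S' \<union> T' \<subseteq> {..<N}"
      and "cube_face N S T \<subseteq> cube_face N S' T'" for S T S' T'
  proof -
    have c: "cube_center N S T \<in> cube_face N S' T'"
      using cube_center_in_cube_face[OF ST] that(4) by blast
    have "i \<in> S" if "i \<in> S'" for i
    proof -
      have "Poly_Mapping.lookup (cube_center N S T) i = 0" using c that by (simp add: cube_face_def)
      then show ?thesis using that ST' by (auto simp: lookup_cube_center split: if_splits)
    qed
    moreover have "i \<in> T" if "i \<in> T'" for i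
    proof -
      have "Poly_Mapping.lookup (cube_center N S T) i = 1" using c that by (simp add: cube_face_def)
      then show ?thesis by (auto simp: lookup_cube_center split: if_splits)
    qed
    ultimately show ?thesis by auto
  qed
  show ?thesis
  proof (rule inj_onI, clarify)
    fix S T S' T'
    assume img: "mat_map A ` cube_face N S T = mat_map A ` cube_face N S' T'"
      and 1: "S \<union> T \<subseteq> {..<N}" "S \<inter> T = {}" "visible A S T"
      and 2: "S' \<union> T' \<subseteq> {..<N}" "S' \<inter> T' = {}" "visible A S' T'"
    have "cube_face N S T \<subseteq> cube_face N S' T'" "cube_face N S' T' \<subseteq> cube_face N S T"
      using sub[OF 2(3) img] sub[OF 1(3) img[symmetric]] by auto
    then show "S = S' \<and> T = T'"
      using ST[OF 1(1,2) 2(1)] ST[OF 2(1,2) 1(1)] by blast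
  qed
qed

section \<open>Dimension of a projected face as a column rank\<close>

definition mat_col :: "real mat \<Rightarrow> nat \<Rightarrow> (nat \<Rightarrow>\<^sub>0 real)" where
  "mat_col A i = mat_map A (Poly_Mapping.single i 1)"

text \<open>Stated for the family of columns, not for the set of their values: two equal columns at
  different indices count as dependent.\<close>

definition indep_columns :: "real mat \<Rightarrow> nat set \<Rightarrow> bool" where
  "indep_columns A J \<longleftrightarrow> (\<forall>v. Poly_Mapping.keys v \<subseteq> J \<longrightarrow> mat_map A v = 0 \<longrightarrow> v = 0)"

lemma indep_columns_subset: "indep_columns A J \<Longrightarrow> K \<subseteq> J \<Longrightarrow> indep_columns A K"
  unfolding indep_columns_def by (meson subset_trans)

lemma poly_mapping_expand:
  fixes v :: "nat \<Rightarrow>\<^sub>0 real"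
  assumes "finite J" "Poly_Mapping.keys v \<subseteq> J"
  shows "v = (\<Sum>i\<in>J. Poly_Mapping.lookup v i *\<^sub>R Poly_Mapping.single i (1::real))"
proof (rule poly_mapping_eqI)
  fix k
  have "Poly_Mapping.lookup (\<Sum>i\<in>J. Poly_Mapping.lookup v i *\<^sub>R Poly_Mapping.single i (1::real)) k
      = (\<Sum>i\<in>J. if k = i then Poly_Mapping.lookup v k else 0)"
    unfolding lookup_sum by (intro sum.cong) (auto simp: lookup_single when_def)
  also have "\<dots> = Poly_Mapping.lookup v k"
    using assms by (auto simp: in_keys_iff)
  finally show "Poly_Mapping.lookup v k =
    Poly_Mapping.lookup (\<Sum>i\<in>J. Poly_Mapping.lookup v i *\<^sub>R Poly_Mapping.single i (1::real)) k" ..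
qed

lemma mat_map_expand:
  assumes "finite J" "Poly_Mapping.keys v \<subseteq> J"
  shows "mat_map A v = (\<Sum>i\<in>J. Poly_Mapping.lookup v i *\<^sub>R mat_col A i)"
  by (subst poly_mapping_expand[OF assms])
     (simp add: linear_sum[OF linear_mat_map] linear_scale[OF linear_mat_map] mat_col_def)

lemma indep_columnsD:
  assumes "indep_columns A J" "finite J" "(\<Sum>i\<in>J. f i *\<^sub>R mat_col A i) = 0" "j \<in> J"
  shows "f j = 0"
proof -
  define v where "v = (\<Sum>i\<in>J. Poly_Mapping.single i (f i))"
  have lv: "Poly_Mapping.lookup v i = (if i \<in> J then f i else 0)" for i
    using assms(2) by (simp add: v_def lookup_sum_single)
  have keys: "Poly_Mapping.keys v \<subseteq> J" by (auto simp: in_keys_iff lv split: if_splits)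
  have "mat_map A v = (\<Sum>i\<in>J. f i *\<^sub>R mat_col A i)"
    unfolding mat_map_expand[OF assms(2) keys] by (intro sum.cong) (auto simp: lv)
  then have "v = 0" using assms keys by (simp add: indep_columns_def)
  then show ?thesis using lv[of j] assms(4) by simp
qed

lemma indep_columns_iff:
  assumes "finite J"
  shows "indep_columns A J \<longleftrightarrow> inj_on (mat_col A) J \<and> independent (mat_col A ` J)"
proof
  assume ind: "indep_columns A J"
  have inj: "inj_on (mat_col A) J"
  proof (rule inj_onI)
    fix i j assume ij: "i \<in> J" "j \<in> J" "mat_col A i = mat_col A j"
    show "i = j"
    proof (rule ccontr)
      assume "i \<noteq> j"
      define f where "f l = (if l = i then 1 else if l = j then -1 else 0 :: real)" for l
      have "(\<Sum>l\<in>J. f l *\<^sub>R mat_col A l) = (\<Sum>l\<in>{i, j}. f l *\<^sub>R mat_col A l)"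
        using ij assms by (intro sum.mono_neutral_right) (auto simp: f_def)
      also have "\<dots> = 0" using \<open>i \<noteq> j\<close> ij by (simp add: f_def)
      finally have "f i = 0" by (rule indep_columnsD[OF ind assms _ ij(1)])
      then show False by (simp add: f_def)
    qed
  qed
  moreover have "independent (mat_col A ` J)"
  proof (rule independent_if_scalars_zero)
    fix f x assume f: "(\<Sum>x\<in>mat_col A ` J. f x *\<^sub>R x) = 0" "x \<in> mat_col A ` J"
    then have "(\<Sum>i\<in>J. f (mat_col A i) *\<^sub>R mat_col A i) = 0"
      by (simp add: sum.reindex[OF inj])
    then show "f x = 0" using indep_columnsD[OF ind assms, of "\<lambda>i. f (mat_col A i)"] f(2) by auto
  qed (use assms in simp)
  ultimately show "inj_on (mat_col A) J \<and> independent (mat_col A ` J)" ..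
next
  assume *: "inj_on (mat_col A) J \<and> independent (mat_col A ` J)"
  show "indep_columns A J"
    unfolding indep_columns_def
  proof (intro allI impI)
    fix v assume v: "Poly_Mapping.keys v \<subseteq> J" "mat_map A v = 0"
    define g where "g = Poly_Mapping.lookup v \<circ> the_inv_into J (mat_col A)"
    have "(\<Sum>x\<in>mat_col A ` J. g x *\<^sub>R x) = (\<Sum>i\<in>J. g (mat_col A i) *\<^sub>R mat_col A i)"
      using * by (simp add: sum.reindex)
    also have "\<dots> = (\<Sum>i\<in>J. Poly_Mapping.lookup v i *\<^sub>R mat_col A i)"
      using * by (intro sum.cong) (simp_all add: g_def the_inv_into_f_f)
    also have "\<dots> = 0" using mat_map_expand[OF assms v(1), of A] v(2) by simp
    finally have 0: "g x = 0" if "x \<in> mat_col A ` J" for x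
      using independentD[of "mat_col A ` J" "mat_col A ` J" g x] * that assms by auto
    have "Poly_Mapping.lookup v i = 0" for i
    proof (cases "i \<in> J")
      case True
      then show ?thesis using 0[of "mat_col A i"] * by (simp add: g_def the_inv_into_f_f)
    next
      case False
      then show ?thesis using v(1) by (auto simp: in_keys_iff)
    qed
    then show "v = 0" by (simp add: poly_mapping_eqI)
  qed
qed

lemma dim_columns_eq_iff:
  assumes "finite J"
  shows "dim (mat_col A ` J) = k \<longleftrightarrow>
    (\<exists>K\<subseteq>J. card K = k \<and> indep_columns A K) \<and> \<not> (\<exists>K\<subseteq>J. card K = Suc k \<and> indep_columns A K)"
proof -
  obtain B where B: "B \<subseteq> mat_col A ` J" "independent B" "mat_col A ` J \<subseteq> span B"
      "card B = dim (mat_col A ` J)"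
    by (rule basis_exists)
  then obtain K0 where K0: "K0 \<subseteq> J" "inj_on (mat_col A) K0" "B = mat_col A ` K0"
    by (meson subset_image_inj)
  have ind0: "indep_columns A K0"
    using B K0 assms by (subst indep_columns_iff) (auto intro: finite_subset)
  have card0: "card K0 = dim (mat_col A ` J)"
    using B K0 by (simp add: card_image)
  have le: "card K \<le> dim (mat_col A ` J)" if "K \<subseteq> J" "indep_columns A K" for K
  proof -
    have fin: "finite K" using that(1) assms by (rule finite_subset)
    have "finite B" using B(1) assms by (auto intro: finite_subset)
    moreover have "mat_col A ` K \<subseteq> span B" using that(1) B(3) by auto
    ultimately have "card (mat_col A ` K) \<le> card B"
      using that(2) fin by (intro independent_span_bound[THEN conjunct2]) (auto simp: indep_columns_iff)
    then show ?thesis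
      using that(2) fin B(4) by (simp add: indep_columns_iff card_image)
  qed
  have ex: "\<exists>K\<subseteq>J. card K = m \<and> indep_columns A K" if m: "m \<le> dim (mat_col A ` J)" for m
  proof -
    obtain K where "K \<subseteq> K0" "card K = m"
      using m card0 obtain_subset_with_card_n[of m K0] by metis
    then show ?thesis
      using ind0 K0(1) indep_columns_subset by blast
  qed
  show ?thesis
  proof
    assume "dim (mat_col A ` J) = k"
    then show "(\<exists>K\<subseteq>J. card K = k \<and> indep_columns A K) \<and> \<not> (\<exists>K\<subseteq>J. card K = Suc k \<and> indep_columns A K)"
      using ex[of k] le[of _] by (metis Suc_n_not_le_n order_refl)
  next
    assume *: "(\<exists>K\<subseteq>J. card K = k \<and> indep_columns A K) \<and> \<not> (\<exists>K\<subseteq>J. card K = Suc k \<and> indep_columns A K)"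
    then have "k \<le> dim (mat_col A ` J)" using le by blast
    moreover have "\<not> Suc k \<le> dim (mat_col A ` J)" using ex * by blast
    ultimately show "dim (mat_col A ` J) = k" by simp
  qed
qed

text \<open>The differences of points of the cube face are supported on the free coordinates.
  Conversely a half step from the midpoint along a free coordinate stays in the face, and twice its
  image is the column.\<close>

lemma set_dim_cube_face_image:
  assumes dim: "dim_col A = N" and ST: "S \<union> T \<subseteq> {..<N}" "S \<inter> T = {}"
  shows "set_dim (mat_map A ` cube_face N S T) = dim (mat_col A ` ({..<N} - S - T))"
proof -
  let ?J = "{..<N} - S - T"
  let ?D = "{x - y |x y. x \<in> mat_map A ` cube_face N S T \<and> y \<in> mat_map A ` cube_face N S T}"
  have "?D \<subseteq> span (mat_col A ` ?J)"
  proof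
    fix d assume "d \<in> ?D"
    then obtain x y where xy: "x \<in> cube_face N S T" "y \<in> cube_face N S T" "d = mat_map A x - mat_map A y"
      by auto
    have keys: "Poly_Mapping.keys (x - y) \<subseteq> ?J"
      using xy by (auto simp: in_keys_iff lookup_minus cube_face_def hypercube_iff) (metis not_le)
    have "d = mat_map A (x - y)" using xy by (simp add: linear_diff[OF linear_mat_map])
    also have "\<dots> = (\<Sum>i\<in>?J. Poly_Mapping.lookup (x - y) i *\<^sub>R mat_col A i)"
      by (rule mat_map_expand[OF _ keys]) simp
    also have "\<dots> \<in> span (mat_col A ` ?J)"
      by (intro span_sum span_scale span_base) auto
    finally show "d \<in> span (mat_col A ` ?J)" .
  qed
  moreover have "mat_col A ` ?J \<subseteq> span ?D"
  proof
    fix d assume "d \<in> mat_col A ` ?J"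
    then obtain i where i: "i \<in> ?J" "d = mat_col A i" by auto
    let ?c = "cube_center N S T" and ?h = "(1/2) *\<^sub>R Poly_Mapping.single i (1::real)"
    have "?c + ?h \<in> cube_face N S T"
      using ST i by (auto simp: cube_face_def hypercube_iff lookup_add lookup_cube_center lookup_single when_def)
    moreover have "?c \<in> cube_face N S T" using ST by (rule cube_center_in_cube_face)
    ultimately have "mat_map A (?c + ?h) - mat_map A ?c \<in> ?D" by blast
    then have "2 *\<^sub>R (mat_map A (?c + ?h) - mat_map A ?c) \<in> span ?D"
      by (intro span_scale span_base)
    then show "d \<in> span ?D"
      unfolding i mat_col_def by (simp add: linear_add[OF linear_mat_map] linear_scale[OF linear_mat_map])
  qed
  ultimately have "span ?D = span (mat_col A ` ?J)"
    by (meson span_eq)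
  then have "dim (span ?D) = dim (span (mat_col A ` ?J))" by simp
  then show ?thesis by (simp only: set_dim_def dim_span)
qed

text \<open>For finite J this is the rank of the columns (\<open>dim_columns_eq_iff\<close>). In
  this form it is a finite Boolean combination of independence conditions, which makes it Borel in
  the entries.\<close>

definition column_rank :: "real mat \<Rightarrow> nat set \<Rightarrow> nat \<Rightarrow> bool" where
  "column_rank A J k \<longleftrightarrow>
    (\<exists>K\<subseteq>J. card K = k \<and> indep_columns A K) \<and> \<not> (\<exists>K\<subseteq>J. card K = Suc k \<and> indep_columns A K)"

text \<open>Valid for every matrix, as measurability requires; without general position the free
  coordinates can outnumber the dimension of the image, so the rank takes their place.\<close>

lemma num_faces_projected_cube:
  assumes "dim_col A = N"
  shows "num_faces k (mat_map A ` hypercube N) =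
    card {(S, T). S \<union> T \<subseteq> {..<N} \<and> S \<inter> T = {} \<and> visible A S T \<and> column_rank A ({..<N} - S - T) k}"
    (is "_ = card ?P")
proof -
  let ?f = "\<lambda>(S, T). mat_map A ` cube_face N S T"
  let ?Q = "{(S, T). S \<union> T \<subseteq> {..<N} \<and> S \<inter> T = {} \<and> visible A S T}"
  have rank: "set_dim (mat_map A ` cube_face N S T) = k \<longleftrightarrow> column_rank A ({..<N} - S - T) k"
    if "S \<union> T \<subseteq> {..<N}" "S \<inter> T = {}" for S T
    unfolding set_dim_cube_face_image[OF assms that] column_rank_def by (simp add: dim_columns_eq_iff)
  have "{F. F face_of mat_map A ` hypercube N \<and> F \<noteq> {} \<and> set_dim F = k} = ?f ` ?P"
  proof (intro Set.set_eqI iffI)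
    fix F assume F: "F \<in> {F. F face_of mat_map A ` hypercube N \<and> F \<noteq> {} \<and> set_dim F = k}"
    then obtain S T where "S \<union> T \<subseteq> {..<N}" "S \<inter> T = {}" "visible A S T" "F = mat_map A ` cube_face N S T"
      using face_imp_visible[OF assms, of F] by auto
    then show "F \<in> ?f ` ?P" using rank F by (auto intro!: image_eqI[of _ _ "(S, T)"])
  next
    fix F assume "F \<in> ?f ` ?P"
    then obtain S T where ST: "S \<union> T \<subseteq> {..<N}" "S \<inter> T = {}" "visible A S T"
        "column_rank A ({..<N} - S - T) k" "F = mat_map A ` cube_face N S T"
      by auto
    moreover have "cube_face N S T \<noteq> {}" using cube_center_in_cube_face[OF ST(1,2)] by auto
    ultimately show "F \<in> {F. F face_of mat_map A ` hypercube N \<and> F \<noteq> {} \<and> set_dim F = k}"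
      using rank visible_imp_face[OF assms ST(3)] by auto
  qed
  moreover have "inj_on ?f ?P"
    by (rule inj_on_subset[OF inj_on_visible_faces[OF assms]]) auto
  ultimately show ?thesis by (simp add: num_faces_def card_image)
qed

text \<open>The pairs are grouped by their set F of free coordinates; given F, the set S determines
  T.\<close>

lemma card_patterns:
  assumes c: "\<And>F. F \<subseteq> {..<N} \<Longrightarrow> card F = k \<Longrightarrow> card {S. S \<subseteq> {..<N} - F \<and> V S ({..<N} - F - S)} = c"
  shows "card {(S, T). S \<union> T \<subseteq> {..<N} \<and> S \<inter> T = {} \<and> V S T \<and> card ({..<N} - S - T) = k} = (N choose k) * c"
    (is "card ?P = _")
proof -
  let ?B = "\<lambda>F. {S. S \<subseteq> {..<N} - F \<and> V S ({..<N} - F - S)}"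
  have "bij_betw (\<lambda>(F, S). (S, {..<N} - F - S)) (Sigma {F. F \<subseteq> {..<N} \<and> card F = k} ?B) ?P"
  proof (rule bij_betwI[where g = "\<lambda>(S, T). ({..<N} - S - T, S)"])
    show "(\<lambda>(F, S). (S, {..<N} - F - S)) \<in> Sigma {F. F \<subseteq> {..<N} \<and> card F = k} ?B \<rightarrow> ?P"
    proof
      fix p assume "p \<in> Sigma {F. F \<subseteq> {..<N} \<and> card F = k} ?B"
      then obtain F S where p: "p = (F, S)" "F \<subseteq> {..<N}" "card F = k" "S \<subseteq> {..<N} - F" "V S ({..<N} - F - S)"
        by blast
      moreover have "{..<N} - S - ({..<N} - F - S) = F" using p by blast
      ultimately show "(\<lambda>(F, S). (S, {..<N} - F - S)) p \<in> ?P" by auto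
    qed
    show "(\<lambda>(S, T). ({..<N} - S - T, S)) \<in> ?P \<rightarrow> Sigma {F. F \<subseteq> {..<N} \<and> card F = k} ?B"
    proof
      fix p assume "p \<in> ?P"
      then obtain S T where p: "p = (S, T)" "S \<union> T \<subseteq> {..<N}" "S \<inter> T = {}" "V S T" "card ({..<N} - S - T) = k"
        by blast
      moreover have "{..<N} - ({..<N} - S - T) - S = T" using p by blast
      ultimately show "(\<lambda>(S, T). ({..<N} - S - T, S)) p \<in> Sigma {F. F \<subseteq> {..<N} \<and> card F = k} ?B" by auto
    qed
  qed auto
  then have "card ?P = card (Sigma {F. F \<subseteq> {..<N} \<and> card F = k} ?B)"
    by (simp add: bij_betw_same_card)
  also have "\<dots> = (\<Sum>F | F \<subseteq> {..<N} \<and> card F = k. card (?B F))"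
    by (intro card_SigmaI ballI) (auto intro: finite_subset[of _ "Pow {..<N}"])
  also have "\<dots> = (N choose k) * c"
    using c by (simp add: n_subsets)
  finally show ?thesis .
qed

lemma column_rank_generic:
  assumes ind: "\<And>K. K \<subseteq> J \<Longrightarrow> card K \<le> Suc k \<Longrightarrow> indep_columns A K" and fin: "finite J"
  shows "column_rank A J k \<longleftrightarrow> card J = k"
proof
  assume rank: "column_rank A J k"
  then have "k \<le> card J"
    using fin by (auto simp: column_rank_def intro: card_mono)
  moreover have "\<not> Suc k \<le> card J"
  proof
    assume "Suc k \<le> card J"
    then obtain K where "K \<subseteq> J" "card K = Suc k"
      by (rule obtain_subset_with_card_n)
    then show False using rank ind[of K] by (auto simp: column_rank_def)
  qed
  ultimately show "card J = k" by simp
next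
  assume J: "card J = k"
  have "card K \<noteq> Suc k" if "K \<subseteq> J" for K
    using card_mono[OF fin that] J by simp
  then show "column_rank A J k"
    using J ind[of J] by (auto simp: column_rank_def)
qed

text \<open>The identity matrix is treated as a projection: its kernel is trivial, so all patterns
  are visible.\<close>

lemma num_faces_hypercube: "num_faces k (hypercube N) = (N choose k) * 2 ^ (N - k)"
proof -
  have id: "mat_map (1\<^sub>m N) x = x" if "x \<in> Rspace N" for x
  proof (rule poly_mapping_eqI)
    fix i
    have "(\<Sum>j<N. 1\<^sub>m N $$ (i, j) * Poly_Mapping.lookup x j) = (\<Sum>j<N. if j = i then Poly_Mapping.lookup x i else 0)"
      if "i < N" using that by (intro sum.cong) auto
    then show "Poly_Mapping.lookup (mat_map (1\<^sub>m N) x) i = Poly_Mapping.lookup x i"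
      using that by (simp add: lookup_mat_map Rspace_iff)
  qed
  have vis: "visible (1\<^sub>m N) S T" for S T
    using id by (auto simp: visible_def)
  have ind: "indep_columns (1\<^sub>m N) K" if "K \<subseteq> {..<N}" for K
    unfolding indep_columns_def
  proof (intro allI impI)
    fix v :: "nat \<Rightarrow>\<^sub>0 real" assume v: "Poly_Mapping.keys v \<subseteq> K" "mat_map (1\<^sub>m N) v = 0"
    then have "v \<in> Rspace N" using that by (auto simp: Rspace_def)
    then show "v = 0" using id v(2) by simp
  qed
  have rank: "column_rank (1\<^sub>m N) ({..<N} - S - T) k \<longleftrightarrow> card ({..<N} - S - T) = k" for S T
    by (intro column_rank_generic ind) auto
  have "mat_map (1\<^sub>m N) ` hypercube N = hypercube N"
    using id by (auto simp: hypercube_def image_iff)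
  then have "num_faces k (hypercube N) =
     card {(S, T). S \<union> T \<subseteq> {..<N} \<and> S \<inter> T = {} \<and> visible (1\<^sub>m N) S T \<and> card ({..<N} - S - T) = k}"
    using num_faces_projected_cube[of "1\<^sub>m N" N k] by (simp add: rank)
  also have "\<dots> = (N choose k) * 2 ^ (N - k)"
  proof (rule card_patterns)
    fix F assume F: "F \<subseteq> {..<N}" "card F = k"
    then have "card ({..<N} - F) = N - k"
      by (simp add: card_Diff_subset finite_subset)
    then show "card {S. S \<subseteq> {..<N} - F \<and> visible (1\<^sub>m N) S ({..<N} - F - S)} = 2 ^ (N - k)"
      using card_Pow[of "{..<N} - F"] by (simp add: Pow_def vis)
  qed
  finally show ?thesis .
qed

text \<open>For J of size at most N - n some n columns K avoid J. They span the target, so a column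
  j in J is a combination of them, and the relation is a kernel vector dual to j on J. A kernel
  vector vanishing on N - n coordinates is supported on n independent columns, hence zero.\<close>

lemma generic_kernel:
  assumes dims: "dim_row A = n" "dim_col A = N" and nN: "n \<le> N"
    and ind: "\<And>J. J \<subseteq> {..<N} \<Longrightarrow> card J = n \<Longrightarrow> indep_columns A J"
  shows "generic_functionals (\<lambda>i x. Poly_Mapping.lookup x i) {v \<in> Rspace N. mat_map A v = 0} {..<N} (N - n)"
  unfolding generic_functionals_def
proof (intro conjI allI impI ballI)
  show "linear (\<lambda>x :: nat \<Rightarrow>\<^sub>0 real. Poly_Mapping.lookup x i)" for i by (rule linear_lookup)
  show "subspace {v \<in> Rspace N. mat_map A v = 0}"
    using subspace_inter[OF subspace_Rspace linear_subspace_kernel[OF linear_mat_map[of A]], of N]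
    by (simp add: Int_def)
  fix J assume J: "J \<subseteq> {..<N}"
  then have finJ: "finite J" by (rule finite_subset) simp
  have cardJ: "card ({..<N} - J) = N - card J" using J finJ by (simp add: card_Diff_subset)
  {
    fix j assume j: "card J \<le> N - n" "j \<in> J"
    have "n \<le> card ({..<N} - J)" using cardJ j nN by linarith
    then obtain K where K: "K \<subseteq> {..<N} - J" "card K = n"
      by (rule obtain_subset_with_card_n)
    have finK: "finite K" using K(1) by (rule finite_subset) simp
    have indK: "inj_on (mat_col A) K" "independent (mat_col A ` K)"
      using ind[of K] K finK indep_columns_iff[of K A] by auto
    have "mat_col A j \<in> span (mat_col A ` K)"
    proof (rule ccontr)
      assume notin: "mat_col A j \<notin> span (mat_col A ` K)"
      \<comment> \<open>All columns lie in the span of n unit vectors, so column j cannot be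
        independent of the n columns in K.\<close>
      define E where "E = (\<lambda>i. Poly_Mapping.single i (1::real)) ` {..<n}"
      have inE: "mat_map A v \<in> span E" for v
      proof -
        have "Poly_Mapping.keys (mat_map A v) \<subseteq> {..<n}"
          by (auto simp: in_keys_iff lookup_mat_map dims split: if_splits)
        then have "mat_map A v = (\<Sum>i<n. Poly_Mapping.lookup (mat_map A v) i *\<^sub>R Poly_Mapping.single i 1)"
          by (intro poly_mapping_expand) auto
        also have "\<dots> \<in> span E" by (intro span_sum span_scale span_base) (auto simp: E_def)
        finally show ?thesis .
      qed
      have "mat_col A j \<notin> mat_col A ` K" using notin span_base[of "mat_col A j" "mat_col A ` K"] by blast
      then have "Suc n = card (insert (mat_col A j) (mat_col A ` K))"
        using finK K(2) indK(1) by (simp add: card_image)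
      also have "\<dots> \<le> card E"
      proof (rule independent_span_bound[THEN conjunct2])
        show "independent (insert (mat_col A j) (mat_col A ` K))"
          using notin indK(2) by (rule independent_insertI)
      qed (use inE in \<open>auto simp: E_def mat_col_def\<close>)
      also have "\<dots> \<le> n" unfolding E_def using card_image_le[of "{..<n}"] by (metis card_lessThan finite_lessThan)
      finally show False by simp
    qed
    then obtain f where f: "mat_col A j = (\<Sum>x\<in>mat_col A ` K. f x *\<^sub>R x)"
      using span_finite[of "mat_col A ` K"] finK by auto
    define v where "v = Poly_Mapping.single j 1 - (\<Sum>i\<in>K. Poly_Mapping.single i (f (mat_col A i)))"
    have lv: "Poly_Mapping.lookup v i = (if i = j then 1 else 0) - (if i \<in> K then f (mat_col A i) else 0)" for i
      using finK by (simp add: v_def lookup_minus lookup_sum_single lookup_single when_def)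
    show "\<exists>u\<in>{v \<in> Rspace N. mat_map A v = 0}. Poly_Mapping.lookup u j = 1 \<and> (\<forall>i\<in>J - {j}. Poly_Mapping.lookup u i = 0)"
    proof (intro bexI[of _ v] conjI ballI CollectI)
      show "v \<in> Rspace N" using j J K(1) by (auto simp: Rspace_iff lv)
      have "Poly_Mapping.single i c = c *\<^sub>R Poly_Mapping.single i (1::real)" for i :: nat and c
        by (rule poly_mapping_eqI) (simp add: lookup_single when_def)
      then have col: "mat_map A (Poly_Mapping.single i c) = c *\<^sub>R mat_col A i" for i c
        unfolding mat_col_def by (metis linear_scale[OF linear_mat_map])
      have "mat_map A v = mat_col A j - (\<Sum>i\<in>K. f (mat_col A i) *\<^sub>R mat_col A i)"
        unfolding v_def linear_diff[OF linear_mat_map] linear_sum[OF linear_mat_map] by (simp add: col flip: mat_col_def)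
      also have "\<dots> = 0" using f indK(1) by (simp add: sum.reindex)
      finally show "mat_map A v = 0" .
      show "Poly_Mapping.lookup v j = 1" using j K(1) by (auto simp: lv)
      show "Poly_Mapping.lookup v i = 0" if "i \<in> J - {j}" for i
        using j K(1) that by (auto simp: lv)
    qed
  }
  {
    fix u assume u: "card J = N - n" "u \<in> {v \<in> Rspace N. mat_map A v = 0}" "\<forall>i\<in>J. Poly_Mapping.lookup u i = 0"
    then have "card ({..<N} - J) = n" using cardJ nN by simp
    then have "indep_columns A ({..<N} - J)" by (intro ind) auto
    moreover have "Poly_Mapping.keys u \<subseteq> {..<N} - J"
      using u by (auto simp: Rspace_def in_keys_iff)
    ultimately show "u = 0" using u by (simp add: indep_columns_def)
  }
qed

text \<open>For a fixed set of free coordinates, the invisible patterns are those met weakly by the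
  kernel on the remaining N - k coordinates, which by general position are the strict sign patterns
  counted by \<open>chambers\<close>.\<close>

lemma num_faces_generic_projection:
  assumes dims: "dim_row A = n" "dim_col A = N" and k: "k < n" and nN: "n \<le> N"
    and ind: "\<And>J. J \<subseteq> {..<N} \<Longrightarrow> card J = n \<Longrightarrow> indep_columns A J"
  shows "num_faces k (mat_map A ` hypercube N) = (N choose k) * (2 ^ (N - k) - chambers (N - k) (N - n))"
proof -
  let ?W = "{v \<in> Rspace N. mat_map A v = 0}" and ?\<phi> = "\<lambda>i x. Poly_Mapping.lookup x i :: real"
  have "num_faces k (mat_map A ` hypercube N) =
    card {(S, T). S \<union> T \<subseteq> {..<N} \<and> S \<inter> T = {} \<and> visible A S T \<and> column_rank A ({..<N} - S - T) k}"
    using dims(2) by (rule num_faces_projected_cube)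
  also have "\<dots> = card {(S, T). S \<union> T \<subseteq> {..<N} \<and> S \<inter> T = {} \<and> visible A S T \<and> card ({..<N} - S - T) = k}"
  proof -
    have small: "indep_columns A K" if "K \<subseteq> {..<N}" "card K \<le> n" for K
    proof -
      have "\<exists>L. K \<subseteq> L \<and> L \<subseteq> {..<N} \<and> card L = n"
        by (rule exists_subset_between) (use that nN in auto)
      then show ?thesis using ind indep_columns_subset by blast
    qed
    have "column_rank A ({..<N} - S - T) k \<longleftrightarrow> card ({..<N} - S - T) = k" for S T
    proof (rule column_rank_generic)
      \<comment> \<open>k < n enters here: excluding rank above k calls for k + 1 independent
        columns, and general position provides up to n.\<close>
      fix K assume "K \<subseteq> {..<N} - S - T" "card K \<le> Suc k"
      then show "indep_columns A K" using k by (intro small) auto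
    qed simp
    then show ?thesis by simp
  qed
  also have "\<dots> = (N choose k) * (2 ^ (N - k) - chambers (N - k) (N - n))"
  proof (rule card_patterns)
    fix F assume F: "F \<subseteq> {..<N}" "card F = k"
    define I where "I = {..<N} - F"
    have I: "I \<subseteq> {..<N}" "finite I" "card I = N - k"
      using F by (auto simp: I_def card_Diff_subset finite_subset)
    then have "I \<noteq> {}" using k nN by auto
    have g: "generic_functionals ?\<phi> ?W I (N - n)"
      by (rule generic_functionals_subset[OF generic_kernel[OF dims nN ind] I(1)])
    have "{S. S \<subseteq> I \<and> visible A S (I - S)} = Pow I - sign_patterns ?\<phi> ?W I"
    proof -
      have "\<not> visible A S (I - S) \<longleftrightarrow> (\<exists>u\<in>?W. (\<forall>i\<in>S. 0 \<le> ?\<phi> i u) \<and> (\<forall>i\<in>I - S. ?\<phi> i u \<le> 0) \<and> (\<exists>i\<in>I. ?\<phi> i u \<noteq> 0))"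
        if "S \<subseteq> I" for S
      proof -
        have "S \<union> (I - S) = I" using that by auto
        then show ?thesis unfolding visible_def dims(2) by auto
      qed
      then show ?thesis
        unfolding weak_sign_patterns[OF I(2) \<open>I \<noteq> {}\<close> g, symmetric] by blast
    qed
    moreover have "sign_patterns ?\<phi> ?W I \<subseteq> Pow I" by (auto simp: sign_patterns_def)
    ultimately have "card {S. S \<subseteq> I \<and> visible A S (I - S)} = 2 ^ (N - k) - chambers (N - k) (N - n)"
      using I card_sign_patterns[OF I(2) g]
      by (simp add: card_Diff_subset finite_subset[of "sign_patterns ?\<phi> ?W I" "Pow I"] card_Pow)
    then show "card {S. S \<subseteq> {..<N} - F \<and> visible A S ({..<N} - F - S)} = 2 ^ (N - k) - chambers (N - k) (N - n)"
      by (simp add: I_def)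
  qed
  finally show ?thesis .
qed

section \<open>Measurability of the face count\<close>

text \<open>The underlying probability space need not be complete, so knowing the face count almost surely
  does not make it integrable; it has to be shown to be a Borel function of the entries.  All
  conditions below have the form: some \<open>c\<close> in a compact box satisfies a closed condition.\<close>

lemma closed_exists_bounded:
  fixes Q :: "'x::topological_space \<Rightarrow> ('i \<Rightarrow> real) \<Rightarrow> bool"
  assumes "closed {p. Q (fst p) (snd p)}"
  shows "closed {x. \<exists>c. (\<forall>j. \<bar>c j\<bar> \<le> m) \<and> Q x c}"
proof -
  \<comment> \<open>The box is compact by Tychonoff's theorem, so the tube lemma shows that
    projecting along it preserves closedness.\<close>
  define K where "K = (Pi\<^sub>E UNIV (\<lambda>_. {-m..m}) :: ('i \<Rightarrow> real) set)"
  have "compactin (product_topology (\<lambda>_. euclidean) UNIV) K"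
    unfolding K_def by (subst compactin_PiE) (auto simp: compactin_euclidean_iff)
  then have K: "compact K"
    by (simp add: euclidean_product_topology compactin_euclidean_iff)
  have memK: "c \<in> K \<longleftrightarrow> (\<forall>j. \<bar>c j\<bar> \<le> m)" for c
    by (auto simp: K_def PiE_iff abs_le_iff minus_le_iff)
  have "open (- {x. \<exists>c\<in>K. Q x c})"
  proof (subst open_subopen, intro ballI)
    fix x assume "x \<in> - {x. \<exists>c\<in>K. Q x c}"
    then have "{x} \<times> K \<subseteq> - {p. Q (fst p) (snd p)}" by auto
    with assms obtain X where "x \<in> X" "open X" "X \<times> K \<subseteq> - {p. Q (fst p) (snd p)}"
      using Elementary_Topology.tube_lemma[OF K, of "- {p. Q (fst p) (snd p)}" x] by auto
    then show "\<exists>T. open T \<and> x \<in> T \<and> T \<subseteq> - {x. \<exists>c\<in>K. Q x c}"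
      by (intro exI[of _ X]) (auto simp: subset_iff)
  qed
  then show ?thesis
    by (simp add: closed_def memK Bex_def)
qed

lemma closed_Collect_Ball: "(\<And>i. i \<in> S \<Longrightarrow> closed {p. P i p}) \<Longrightarrow> closed {p. \<forall>i\<in>S. P i p}"
  unfolding Collect_ball_eq by (rule closed_INT) auto

lemma continuous_on_fst_coordinate: "continuous_on UNIV (\<lambda>p. fst p i :: real)"
  by (rule continuous_on_compose2[OF continuous_on_product_coordinates continuous_on_fst[OF continuous_on_id]]) simp

lemma continuous_on_snd_coordinate: "continuous_on UNIV (\<lambda>p. snd p i :: real)"
  by (rule continuous_on_compose2[OF continuous_on_product_coordinates continuous_on_snd[OF continuous_on_id]]) simp

lemmas closed_entry_intros = closed_Collect_conj closed_Collect_Ball closed_Collect_eq closed_Collect_le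
  continuous_on_sum continuous_on_mult continuous_on_rabs continuous_on_const
  continuous_on_fst_coordinate continuous_on_snd_coordinate

text \<open>Injectivity of the block with rows I and columns J. The matrix is a plain function of
  index pairs, so that the condition defines a subset of a topological product space.\<close>

definition nonsingular :: "(nat \<times> nat \<Rightarrow> real) \<Rightarrow> nat set \<Rightarrow> nat set \<Rightarrow> bool" where
  "nonsingular g I J \<longleftrightarrow>
     (\<forall>c. (\<forall>i\<in>I. (\<Sum>j\<in>J. g (i, j) * c j) = 0) \<longrightarrow> (\<forall>j\<in>J. c j = 0))"

text \<open>A kernel vector can be set to 0 off J and scaled to l1 norm 1. This places it in a
  compact box, and the norm equation keeps the zero vector out by a closed condition.\<close>

lemma closed_singular:
  assumes "finite J"
  shows "closed {g. \<not> nonsingular g I J}"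
proof -
  let ?Q = "\<lambda>g c. (\<forall>i\<in>I. (\<Sum>j\<in>J. g (i, j) * c j) = 0) \<and> (\<Sum>j\<in>J. \<bar>c j :: real\<bar>) = 1"
  have "\<not> nonsingular g I J \<longleftrightarrow> (\<exists>c. (\<forall>j. \<bar>c j\<bar> \<le> 1) \<and> ?Q g c)" for g
  proof
    assume "\<not> nonsingular g I J"
    then obtain c j where c: "\<forall>i\<in>I. (\<Sum>j\<in>J. g (i, j) * c j) = 0" "j \<in> J" "c j \<noteq> 0"
      by (auto simp: nonsingular_def)
    define s where "s = (\<Sum>j\<in>J. \<bar>c j\<bar>)"
    have le: "\<bar>c k\<bar> \<le> s" if "k \<in> J" for k
      unfolding s_def using member_le_sum[OF that, of "\<lambda>k. \<bar>c k\<bar>"] assms by simp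
    have s: "s > 0" using le[OF c(2)] c(3) by simp
    define d where "d k = (if k \<in> J then c k / s else 0)" for k
    have "(\<Sum>j\<in>J. g (i, j) * d j) = (\<Sum>j\<in>J. g (i, j) * c j) / s" for i
      unfolding sum_divide_distrib by (intro sum.cong) (auto simp: d_def)
    moreover have "(\<Sum>j\<in>J. \<bar>d j\<bar>) = s / s"
      unfolding sum_divide_distrib s_def using s by (intro sum.cong) (auto simp: d_def s_def)
    moreover have "\<bar>d k\<bar> \<le> 1" for k
      using le[of k] s by (simp add: d_def)
    ultimately show "\<exists>c. (\<forall>j. \<bar>c j\<bar> \<le> 1) \<and> ?Q g c"
      using c s by (intro exI[of _ d]) auto
  next
    assume "\<exists>c. (\<forall>j. \<bar>c j\<bar> \<le> 1) \<and> ?Q g c"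
    then obtain c where c: "?Q g c" by blast
    then have "\<exists>j\<in>J. c j \<noteq> 0" by (metis abs_zero sum.neutral zero_neq_one)
    then show "\<not> nonsingular g I J" using c by (auto simp: nonsingular_def)
  qed
  moreover have "closed {g. \<exists>c. (\<forall>j. \<bar>c j\<bar> \<le> 1) \<and> ?Q g c}"
    by (intro closed_exists_bounded closed_entry_intros)
  ultimately show ?thesis by simp
qed

definition cone_free :: "(nat \<times> nat \<Rightarrow> real) \<Rightarrow> nat \<Rightarrow> nat \<Rightarrow> nat set \<Rightarrow> nat set \<Rightarrow> bool" where
  "cone_free g n N S T \<longleftrightarrow>
     (\<forall>c. (\<forall>i<n. (\<Sum>j<N. g (i, j) * c j) = 0) \<longrightarrow> (\<forall>i\<in>S. 0 \<le> c i) \<longrightarrow> (\<forall>i\<in>T. c i \<le> 0) \<longrightarrow>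
        (\<forall>i\<in>S \<union> T. c i = 0))"

text \<open>Only the coordinates in S and T can be normalised; the free ones have no common bound.
  The complement is therefore written as a countable union of closed sets, one for each size m of
  the box.\<close>

lemma borel_cone_free:
  assumes ST: "S \<union> T \<subseteq> {..<N}"
  shows "{g. cone_free g n N S T} \<in> sets borel"
proof -
  let ?Q = "\<lambda>g c. (\<forall>i\<in>{..<n}. (\<Sum>j<N. g (i, j) * c j) = 0) \<and> (\<forall>i\<in>S. 0 \<le> c i) \<and> (\<forall>i\<in>T. c i \<le> 0) \<and>
      (\<Sum>i\<in>S \<union> T. \<bar>c i :: real\<bar>) = 1"
  have fin: "finite (S \<union> T)" using ST finite_subset by blast
  have "\<not> cone_free g n N S T \<longleftrightarrow> (\<exists>m::nat. \<exists>c. (\<forall>j. \<bar>c j\<bar> \<le> real m) \<and> ?Q g c)" for g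
  proof
    assume "\<not> cone_free g n N S T"
    then obtain c i where c: "\<forall>i<n. (\<Sum>j<N. g (i, j) * c j) = 0" "\<forall>i\<in>S. 0 \<le> c i" "\<forall>i\<in>T. c i \<le> 0"
        "i \<in> S \<union> T" "c i \<noteq> 0"
      unfolding cone_free_def by blast
    define s where "s = (\<Sum>j\<in>S \<union> T. \<bar>c j\<bar>)"
    have "\<bar>c i\<bar> \<le> s"
      unfolding s_def using member_le_sum[OF c(4), of "\<lambda>k. \<bar>c k\<bar>"] fin by simp
    then have s: "s > 0" using c(5) by simp
    \<comment> \<open>Setting the coordinates from N on to 0 leaves finitely many values to bound by
      m.\<close>
    define d where "d k = (if k < N then c k / s else 0)" for k
    define m where "m = nat \<lceil>\<Sum>k<N. \<bar>d k\<bar>\<rceil>"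
    have "\<bar>d k\<bar> \<le> real m" for k
    proof (cases "k < N")
      case True
      then have "\<bar>d k\<bar> \<le> (\<Sum>k<N. \<bar>d k\<bar>)"
        using member_le_sum[of k "{..<N}" "\<lambda>k. \<bar>d k\<bar>"] by simp
      also have "\<dots> \<le> real m" unfolding m_def by (rule real_nat_ceiling_ge)
      finally show ?thesis .
    qed (simp add: d_def)
    moreover have "(\<Sum>j<N. g (i, j) * d j) = (\<Sum>j<N. g (i, j) * c j) / s" for i
      unfolding sum_divide_distrib by (intro sum.cong) (auto simp: d_def)
    moreover have "(\<Sum>j\<in>S \<union> T. \<bar>d j\<bar>) = (\<Sum>j\<in>S \<union> T. \<bar>c j\<bar> / s)"
      using s ST by (intro sum.cong) (auto simp: d_def)
    then have "(\<Sum>j\<in>S \<union> T. \<bar>d j\<bar>) = 1"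
      using s by (simp add: s_def flip: sum_divide_distrib)
    moreover have "\<forall>i\<in>S. 0 \<le> d i" "\<forall>i\<in>T. d i \<le> 0"
      using c s ST by (auto simp: d_def divide_nonpos_pos)
    ultimately show "\<exists>m::nat. \<exists>c. (\<forall>j. \<bar>c j\<bar> \<le> real m) \<and> ?Q g c"
      using c(1) by (intro exI[of _ m] exI[of _ d]) simp
  next
    assume "\<exists>m::nat. \<exists>c. (\<forall>j. \<bar>c j\<bar> \<le> real m) \<and> ?Q g c"
    then obtain c where c: "?Q g c" by blast
    then have "\<exists>i\<in>S \<union> T. c i \<noteq> 0" by (metis abs_zero sum.neutral zero_neq_one)
    then show "\<not> cone_free g n N S T" using c unfolding cone_free_def by auto
  qed
  then have "{g. \<not> cone_free g n N S T} = {g. \<exists>m::nat. \<exists>c. (\<forall>j. \<bar>c j\<bar> \<le> real m) \<and> ?Q g c}"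
    by (rule Collect_cong)
  also have "\<dots> = (\<Union>m::nat. {g. \<exists>c. (\<forall>j. \<bar>c j\<bar> \<le> real m) \<and> ?Q g c})"
    by (rule Collect_ex_eq)
  also have "\<dots> \<in> sets borel"
  proof (rule sets.countable_UN, rule image_subsetI)
    fix m :: nat
    have "closed {g. \<exists>c. (\<forall>j. \<bar>c j\<bar> \<le> real m) \<and> ?Q g c}"
      by (intro closed_exists_bounded closed_entry_intros)
    then show "{g. \<exists>c. (\<forall>j. \<bar>c j\<bar> \<le> real m) \<and> ?Q g c} \<in> sets borel" by (rule borel_closed)
  qed
  finally have "- {g. \<not> cone_free g n N S T} \<in> sets borel" by (rule borel_comp)
  moreover have "- {g. \<not> cone_free g n N S T} = {g. cone_free g n N S T}" by auto
  ultimately show ?thesis by simp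
qed

lemma borel_nonsingular:
  assumes "finite J"
  shows "{g. nonsingular g I J} \<in> sets borel"
proof -
  have "{g. nonsingular g I J} = - {g. \<not> nonsingular g I J}" by auto
  then show ?thesis using closed_singular[OF assms] by (simp add: borel_comp borel_closed)
qed

section \<open>From matrices to functions of their entries\<close>

lemma visible_iff_cone_free:
  assumes dims: "dim_row A = n" "dim_col A = N" and ST: "S \<union> T \<subseteq> {..<N}"
    and g: "\<And>i j. i < n \<Longrightarrow> j < N \<Longrightarrow> A $$ (i, j) = g (i, j)"
  shows "visible A S T \<longleftrightarrow> cone_free g n N S T"
proof
  assume vis: "visible A S T"
  show "cone_free g n N S T"
    unfolding cone_free_def
  proof (intro allI impI)
    fix c assume c: "\<forall>i<n. (\<Sum>j<N. g (i, j) * c j) = 0" "\<forall>i\<in>S. 0 \<le> c i" "\<forall>i\<in>T. c i \<le> 0"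
    define v where "v = (\<Sum>i<N. Poly_Mapping.single i (c i))"
    have lv: "Poly_Mapping.lookup v i = (if i < N then c i else 0)" for i
      by (simp add: v_def lookup_sum_single)
    have "mat_map A v = 0"
      using c(1) g by (simp add: mat_map_eq_0_iff dims lv)
    moreover have "v \<in> Rspace (dim_col A)" by (simp add: Rspace_iff lv dims)
    moreover have "\<forall>i\<in>S. 0 \<le> Poly_Mapping.lookup v i" "\<forall>i\<in>T. Poly_Mapping.lookup v i \<le> 0"
      using c by (auto simp: lv)
    ultimately have "\<forall>i\<in>S \<union> T. Poly_Mapping.lookup v i = 0"
      using vis unfolding visible_def by blast
    moreover have "Poly_Mapping.lookup v i = c i" if "i \<in> S \<union> T" for i
      using that ST by (auto simp: lv)
    ultimately show "\<forall>i\<in>S \<union> T. c i = 0" by simp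
  qed
next
  assume cf: "cone_free g n N S T"
  show "visible A S T"
    unfolding visible_def
  proof (intro ballI impI)
    fix v i assume v: "mat_map A v = 0" "\<forall>i\<in>S. 0 \<le> Poly_Mapping.lookup v i"
      "\<forall>i\<in>T. Poly_Mapping.lookup v i \<le> 0" "i \<in> S \<union> T"
    have "\<forall>i<n. (\<Sum>j<N. g (i, j) * Poly_Mapping.lookup v j) = 0"
      using v(1) g by (simp add: mat_map_eq_0_iff dims)
    then show "Poly_Mapping.lookup v i = 0"
      by (intro cf[unfolded cone_free_def, rule_format, of "Poly_Mapping.lookup v" i]) (use v in auto)
  qed
qed

lemma indep_columns_iff_nonsingular:
  assumes dims: "dim_row A = n" "dim_col A = N" and J: "J \<subseteq> {..<N}"
    and g: "\<And>i j. i < n \<Longrightarrow> j < N \<Longrightarrow> A $$ (i, j) = g (i, j)"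
  shows "indep_columns A J \<longleftrightarrow> nonsingular g {..<n} J"
proof
  assume ind: "indep_columns A J"
  show "nonsingular g {..<n} J"
    unfolding nonsingular_def
  proof (intro allI impI)
    fix c assume c: "\<forall>i\<in>{..<n}. (\<Sum>j\<in>J. g (i, j) * c j) = 0"
    define v where "v = (\<Sum>i\<in>J. Poly_Mapping.single i (c i))"
    have lv: "Poly_Mapping.lookup v i = (if i \<in> J then c i else 0)" for i
      using finite_subset[OF J] by (simp add: v_def lookup_sum_single)
    have "(\<Sum>j<N. A $$ (i, j) * Poly_Mapping.lookup v j) = (\<Sum>j\<in>J. g (i, j) * c j)" if "i < n" for i
      using J g that by (intro sum.mono_neutral_cong_right) (auto simp: lv)
    then have "mat_map A v = 0"
      using c by (simp add: mat_map_eq_0_iff dims)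
    moreover have "Poly_Mapping.keys v \<subseteq> J" by (auto simp: in_keys_iff lv split: if_splits)
    ultimately have "v = 0" using ind by (simp add: indep_columns_def)
    then show "\<forall>j\<in>J. c j = 0" using lv by (metis lookup_zero)
  qed
next
  assume ns: "nonsingular g {..<n} J"
  show "indep_columns A J"
    unfolding indep_columns_def
  proof (intro allI impI)
    fix v :: "nat \<Rightarrow>\<^sub>0 real" assume v: "Poly_Mapping.keys v \<subseteq> J" "mat_map A v = 0"
    then have lv: "Poly_Mapping.lookup v j = 0" if "j \<notin> J" for j
      using that by (auto simp: in_keys_iff)
    have "(\<Sum>j<N. A $$ (i, j) * Poly_Mapping.lookup v j) = (\<Sum>j\<in>J. g (i, j) * Poly_Mapping.lookup v j)" if "i < n" for i
      using J g that by (intro sum.mono_neutral_cong_right) (auto simp: lv)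
    then have "\<forall>i\<in>{..<n}. (\<Sum>j\<in>J. g (i, j) * Poly_Mapping.lookup v j) = 0"
      using v(2) by (simp add: mat_map_eq_0_iff dims)
    then have "\<forall>j\<in>J. Poly_Mapping.lookup v j = 0"
      using ns unfolding nonsingular_def by blast
    then show "v = 0" using lv by (metis lookup_zero poly_mapping_eqI)
  qed
qed

text \<open>The face count is a finite sum of indicators over all pairs (S, T), each depending on
  the entries through Borel conditions.\<close>

lemma measurable_num_faces:
  assumes G: "G \<in> borel_measurable M"
    and dims: "\<And>\<omega>. \<omega> \<in> space M \<Longrightarrow> dim_row (A \<omega>) = n \<and> dim_col (A \<omega>) = N"
    and g: "\<And>\<omega> i j. \<omega> \<in> space M \<Longrightarrow> i < n \<Longrightarrow> j < N \<Longrightarrow> A \<omega> $$ (i, j) = G \<omega> (i, j)"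
  shows "(\<lambda>\<omega>. real (num_faces k (mat_map (A \<omega>) ` hypercube N))) \<in> borel_measurable M"
proof -
  define X where "X = {(S, T). S \<union> T \<subseteq> {..<N} \<and> S \<inter> T = {}}"
  have finX: "finite X"
    by (rule finite_subset[of _ "Pow {..<N} \<times> Pow {..<N}"]) (auto simp: X_def)
  define rk where "rk g J = ((\<exists>K\<in>{K. K \<subseteq> J \<and> card K = k}. nonsingular g {..<n} K) \<and>
      \<not> (\<exists>K\<in>{K. K \<subseteq> J \<and> card K = Suc k}. nonsingular g {..<n} K))" for g J
  have rk_iff: "column_rank (A \<omega>) J k \<longleftrightarrow> rk (G \<omega>) J" if "\<omega> \<in> space M" "J \<subseteq> {..<N}" for \<omega> J
  proof -
    have "indep_columns (A \<omega>) K \<longleftrightarrow> nonsingular (G \<omega>) {..<n} K" if "K \<subseteq> J" for K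
      by (rule indep_columns_iff_nonsingular) (use dims g \<open>\<omega> \<in> space M\<close> \<open>J \<subseteq> _\<close> that in auto)
    then show ?thesis unfolding column_rank_def rk_def by auto
  qed
  have vis_iff: "visible (A \<omega>) S T \<longleftrightarrow> cone_free (G \<omega>) n N S T" if "\<omega> \<in> space M" "S \<union> T \<subseteq> {..<N}" for \<omega> S T
    by (rule visible_iff_cone_free) (use dims g that in auto)
  have "real (num_faces k (mat_map (A \<omega>) ` hypercube N)) =
      (\<Sum>(S, T)\<in>X. of_bool (cone_free (G \<omega>) n N S T \<and> rk (G \<omega>) ({..<N} - S - T)))"
    if \<omega>: "\<omega> \<in> space M" for \<omega>
  proof -
    have "num_faces k (mat_map (A \<omega>) ` hypercube N) =
        card {(S, T). S \<union> T \<subseteq> {..<N} \<and> S \<inter> T = {} \<and> visible (A \<omega>) S T \<and> column_rank (A \<omega>) ({..<N} - S - T) k}"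
      using dims[OF \<omega>] by (intro num_faces_projected_cube) simp
    also have "{(S, T). S \<union> T \<subseteq> {..<N} \<and> S \<inter> T = {} \<and> visible (A \<omega>) S T \<and> column_rank (A \<omega>) ({..<N} - S - T) k}
        = {p \<in> X. case p of (S, T) \<Rightarrow> cone_free (G \<omega>) n N S T \<and> rk (G \<omega>) ({..<N} - S - T)}"
    proof -
      have "column_rank (A \<omega>) ({..<N} - S - T) k \<longleftrightarrow> rk (G \<omega>) ({..<N} - S - T)" for S T
        by (rule rk_iff[OF \<omega>]) auto
      with vis_iff[OF \<omega>] show ?thesis by (auto simp: X_def)
    qed
    finally show ?thesis
      using finX by (simp add: case_prod_beta sum_of_bool_eq Int_def)
  qed
  then have eq: "(\<lambda>\<omega>. real (num_faces k (mat_map (A \<omega>) ` hypercube N))) \<in> borel_measurable M \<longleftrightarrow>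
      (\<lambda>\<omega>. \<Sum>(S, T)\<in>X. (of_bool (cone_free (G \<omega>) n N S T \<and> rk (G \<omega>) ({..<N} - S - T)) :: real))
        \<in> borel_measurable M"
    by (rule measurable_cong)
  have pull: "{\<omega> \<in> space M. P (G \<omega>)} \<in> sets M" if "{g. P g} \<in> sets borel" for P
    using measurable_sets[OF G that] by (simp add: vimage_def Int_def conj_commute)
  have fin: "finite {K. K \<subseteq> {..<N} - S - T \<and> card K = r}" for S T r
    by (rule finite_subset[of _ "Pow {..<N}"]) auto
  have meas: "Measurable.pred M (\<lambda>\<omega>. cone_free (G \<omega>) n N S T \<and> rk (G \<omega>) ({..<N} - S - T))" if "(S, T) \<in> X" for S T
  proof -
    have "Measurable.pred M (\<lambda>\<omega>. cone_free (G \<omega>) n N S T)"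
      using pull[OF borel_cone_free[of S T N n]] that by (simp add: X_def pred_def)
    moreover have "Measurable.pred M (\<lambda>\<omega>. nonsingular (G \<omega>) {..<n} K)" if "K \<subseteq> {..<N} - S - T" for K
    proof -
      have "finite K" using that by (rule finite_subset) auto
      from pull[OF borel_nonsingular[OF this]] show ?thesis by (simp add: pred_def)
    qed
    then have "Measurable.pred M (\<lambda>\<omega>. \<exists>K\<in>{K. K \<subseteq> {..<N} - S - T \<and> card K = r}. nonsingular (G \<omega>) {..<n} K)" for r
      by (intro pred_intros_finite fin) auto
    ultimately show ?thesis unfolding rk_def by (intro pred_intros_logic)
  qed
  show ?thesis
    unfolding eq
  proof (rule borel_measurable_sum)
    fix p assume "p \<in> X"
    then obtain S T where p: "p = (S, T)" "(S, T) \<in> X" by (cases p) auto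
    have "(\<lambda>\<omega>. of_bool (cone_free (G \<omega>) n N S T \<and> rk (G \<omega>) ({..<N} - S - T)) :: real) =
        indicator {\<omega>. cone_free (G \<omega>) n N S T \<and> rk (G \<omega>) ({..<N} - S - T)}"
      by (auto simp: indicator_def)
    also have "\<dots> \<in> borel_measurable M"
      using meas[OF p(2)] by (subst borel_measurable_indicator_iff) (simp add: pred_def Int_def conj_commute)
    finally show "(\<lambda>\<omega>. case p of (S, T) \<Rightarrow> (of_bool (cone_free (G \<omega>) n N S T \<and> rk (G \<omega>) ({..<N} - S - T)) :: real))
        \<in> borel_measurable M"
      by (simp add: p)
  qed
qed

section \<open>General position of a random rotation\<close>

definition givens :: "nat \<Rightarrow> nat \<Rightarrow> nat \<Rightarrow> real \<Rightarrow> real mat" where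
  "givens N p q t = Matrix.mat N N (\<lambda>(i, j).
     if i = p then (if j = p then cos t else if j = q then sin t else 0)
     else if i = q then (if j = p then - sin t else if j = q then cos t else 0)
     else if i = j then 1 else 0)"

lemma givens_carrier [simp]: "givens N p q t \<in> carrier_mat N N"
  by (simp add: givens_def)

lemma givens_row:
  assumes "p < N" "q < N" "p \<noteq> q" "i < N"
  shows "(\<Sum>k<N. givens N p q t $$ (i, k) * x k) =
    (if i = p then cos t * x p + sin t * x q else if i = q then cos t * x q - sin t * x p else x i)"
proof -
  have "(\<Sum>k<N. givens N p q t $$ (i, k) * x k) = (\<Sum>k\<in>{p, q} \<union> {i}. givens N p q t $$ (i, k) * x k)"
    using assms by (intro sum.mono_neutral_right) (auto simp: givens_def)
  also have "\<dots> = (if i = p then cos t * x p + sin t * x q else if i = q then cos t * x q - sin t * x p else x i)"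
    using assms by (auto simp: givens_def insert_commute)
  finally show ?thesis .
qed

lemma mult_mat_entry:
  assumes "A \<in> carrier_mat N N" "B \<in> carrier_mat N N" "i < N" "j < N"
  shows "(A * B) $$ (i, j) = (\<Sum>k<N. A $$ (i, k) * B $$ (k, j))"
  using assms by (auto simp: scalar_prod_def lessThan_atLeast0 intro!: sum.cong)

lemma givens_add:
  assumes "p < N" "q < N" "p \<noteq> q"
  shows "givens N p q s * givens N p q t = givens N p q (s + t)"
proof (rule eq_matI)
  fix i j assume "i < dim_row (givens N p q (s + t))" "j < dim_col (givens N p q (s + t))"
  then have ij: "i < N" "j < N" by (auto simp: givens_def)
  have "(givens N p q s * givens N p q t) $$ (i, j)
      = (\<Sum>k<N. givens N p q s $$ (i, k) * givens N p q t $$ (k, j))"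
    using ij by (intro mult_mat_entry) auto
  also have "\<dots> = givens N p q (s + t) $$ (i, j)"
    unfolding givens_row[OF assms ij(1)]
    using assms ij by (auto simp: givens_def cos_add sin_add)
  finally show "(givens N p q s * givens N p q t) $$ (i, j) = givens N p q (s + t) $$ (i, j)" .
qed (auto simp: givens_def)

lemma givens_transpose: "p \<noteq> q \<Longrightarrow> transpose_mat (givens N p q t) = givens N p q (- t)"
  by (rule eq_matI) (auto simp: givens_def)

lemma givens_0: "givens N p q 0 = 1\<^sub>m N"
  by (rule eq_matI) (auto simp: givens_def)

lemma givens_in_rotations:
  assumes "p < N" "q < N" "p \<noteq> q"
  shows "givens N p q t \<in> rotations N"
proof -
  have orth: "givens N p q s * transpose_mat (givens N p q s) = 1\<^sub>m N" for s
    using assms by (simp add: givens_transpose givens_add givens_0)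
  text \<open>The half-angle square avoids expanding the determinant.\<close>
  let ?h = "givens N p q (t / 2)"
  have "Determinant.det (givens N p q t) = Determinant.det ?h * Determinant.det ?h"
    using givens_add[OF assms, of "t / 2" "t / 2"] det_mult[of ?h N ?h] by simp
  also have "\<dots> = Determinant.det (?h * transpose_mat ?h)"
    by (subst det_mult[of _ N]) (simp_all add: det_transpose[of _ N])
  also have "\<dots> = 1" by (simp add: orth)
  finally show ?thesis by (simp add: rotations_def orth)
qed

text \<open>For square matrices the right inverse \<open>transpose_mat U\<close> is also a left
  inverse, and applying it to U c = 0 recovers c.\<close>

lemma rotation_kernel:
  assumes U: "U \<in> rotations N" and c: "\<And>i. i < N \<Longrightarrow> (\<Sum>j<N. U $$ (i, j) * c j) = 0" and "k < N"
  shows "c k = (0::real)"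
proof -
  have carr: "U \<in> carrier_mat N N" "transpose_mat U \<in> carrier_mat N N" and orth: "U * transpose_mat U = 1\<^sub>m N"
    using U by (auto simp: rotations_def)
  have inv: "transpose_mat U * U = 1\<^sub>m N"
    by (rule mat_mult_left_right_inverse[OF carr orth])
  have "c k = (\<Sum>j<N. 1\<^sub>m N $$ (k, j) * c j)"
  proof -
    have "(\<Sum>j<N. 1\<^sub>m N $$ (k, j) * c j) = (\<Sum>j<N. if j = k then c k else 0)"
      using \<open>k < N\<close> by (intro sum.cong) auto
    then show ?thesis using \<open>k < N\<close> by simp
  qed
  also have "\<dots> = (\<Sum>j<N. (\<Sum>i<N. U $$ (i, k) * U $$ (i, j)) * c j)"
  proof (rule sum.cong)
    fix j assume "j \<in> {..<N}"
    then have "1\<^sub>m N $$ (k, j) = (\<Sum>i<N. transpose_mat U $$ (k, i) * U $$ (i, j))"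
      unfolding inv[symmetric] using \<open>k < N\<close> carr by (intro mult_mat_entry) auto
    also have "\<dots> = (\<Sum>i<N. U $$ (i, k) * U $$ (i, j))"
      using \<open>k < N\<close> carr by (intro sum.cong) auto
    finally show "1\<^sub>m N $$ (k, j) * c j = (\<Sum>i<N. U $$ (i, k) * U $$ (i, j)) * c j" by simp
  qed simp
  also have "\<dots> = (\<Sum>j<N. \<Sum>i<N. U $$ (i, k) * (U $$ (i, j) * c j))"
    by (simp add: sum_distrib_right mult.assoc)
  also have "\<dots> = (\<Sum>i<N. \<Sum>j<N. U $$ (i, k) * (U $$ (i, j) * c j))"
    by (rule sum.swap)
  also have "\<dots> = (\<Sum>i<N. U $$ (i, k) * (\<Sum>j<N. U $$ (i, j) * c j))"
    by (simp add: sum_distrib_left)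
  also have "\<dots> = 0" using c by simp
  finally show ?thesis .
qed

text \<open>Over a nonsingular block, the solutions on one additional column form a line.\<close>

lemma kernel_row_transfer:
  fixes c d a :: "nat \<Rightarrow> real"
  assumes ns: "nonsingular g I J" and J: "finite J" "j0 \<notin> J"
    and c: "\<And>i. i \<in> I \<Longrightarrow> (\<Sum>j\<in>insert j0 J. g (i, j) * c j) = 0"
    and d: "\<And>i. i \<in> I \<Longrightarrow> (\<Sum>j\<in>insert j0 J. g (i, j) * d j) = 0"
    and nz: "\<exists>j\<in>insert j0 J. d j \<noteq> 0"
    and row: "(\<Sum>j\<in>insert j0 J. a j * d j) = 0"
  shows "(\<Sum>j\<in>insert j0 J. a j * c j) = 0"
proof -
  have "d j0 \<noteq> 0"
  proof
    assume "d j0 = 0"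
    then have "\<forall>i\<in>I. (\<Sum>j\<in>J. g (i, j) * d j) = 0" using d J by simp
    then have "\<forall>j\<in>J. d j = 0" using ns by (simp add: nonsingular_def)
    then show False using nz \<open>d j0 = 0\<close> by auto
  qed
  \<comment> \<open>This combination eliminates column j0, so nonsingularity on J forces e = 0: c
    and d are proportional.\<close>
  define e where "e j = d j0 * c j - c j0 * d j" for j
  have "(\<Sum>j\<in>J. g (i, j) * e j) = 0" if "i \<in> I" for i
  proof -
    have "(\<Sum>j\<in>J. g (i, j) * e j) = d j0 * (\<Sum>j\<in>insert j0 J. g (i, j) * c j) - c j0 * (\<Sum>j\<in>insert j0 J. g (i, j) * d j)"
      using J by (simp add: e_def sum_subtractf sum_distrib_left algebra_simps)
    then show ?thesis using c d that by simp
  qed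
  then have "\<forall>j\<in>J. e j = 0" using ns by (simp add: nonsingular_def)
  then have ratio: "d j0 * c j = c j0 * d j" if "j \<in> insert j0 J" for j
    using that by (auto simp: e_def)
  have "d j0 * (\<Sum>j\<in>insert j0 J. a j * c j) = (\<Sum>j\<in>insert j0 J. a j * (d j0 * c j))"
    by (simp add: sum_distrib_left mult.left_commute)
  also have "\<dots> = (\<Sum>j\<in>insert j0 J. a j * (c j0 * d j))"
    by (intro sum.cong) (simp_all only: ratio)
  also have "\<dots> = c j0 * (\<Sum>j\<in>insert j0 J. a j * d j)"
    by (simp add: sum_distrib_left mult.left_commute)
  finally show ?thesis using row \<open>d j0 \<noteq> 0\<close> by simp
qed

lemma singularE:
  assumes "\<not> nonsingular g I J"
  obtains c where "\<forall>i\<in>I. (\<Sum>j\<in>J. g (i, j) * c j) = 0" "\<exists>j\<in>J. c j \<noteq> 0"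
  using assms unfolding nonsingular_def by blast

lemma nonsingular_cong:
  assumes "\<And>i j. i \<in> I \<Longrightarrow> j \<in> J \<Longrightarrow> g (i, j) = h (i, j)"
  shows "nonsingular g I J = nonsingular h I J"
proof -
  have "(\<Sum>j\<in>J. g (i, j) * c j) = (\<Sum>j\<in>J. h (i, j) * c j)" if "i \<in> I" for i c
    using assms that by (intro sum.cong) auto
  then show ?thesis by (simp add: nonsingular_def)
qed

text \<open>The kernel vectors c at angle t and d at angle s both solve the first m rows, hence are
  proportional. So c is annihilated by row m at both angles, which yields that the original rows m
  and l annihilate it. Then row l at angle t does so too, against the nonsingularity of the block
  with l in place of m.\<close>

lemma rotated_rows_exclusive:
  fixes g :: "nat \<times> nat \<Rightarrow> real" and gt :: "real \<Rightarrow> nat \<times> nat \<Rightarrow> real"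
  assumes J: "finite J" "j0 \<notin> J" and l: "m < l"
    and low: "\<And>t i j. i < m \<Longrightarrow> j \<in> insert j0 J \<Longrightarrow> gt t (i, j) = g (i, j)"
    and rm: "\<And>t j. j \<in> insert j0 J \<Longrightarrow> gt t (m, j) = cos t * g (m, j) + sin t * g (l, j)"
    and rl: "\<And>t j. j \<in> insert j0 J \<Longrightarrow> gt t (l, j) = cos t * g (l, j) - sin t * g (m, j)"
    and st: "sin (s - t) \<noteq> 0"
    and t: "nonsingular (gt t) {..<m} J" "\<not> nonsingular (gt t) {..<Suc m} (insert j0 J)"
      "nonsingular (gt t) (insert l {..<m}) (insert j0 J)"
    and s: "\<not> nonsingular (gt s) {..<Suc m} (insert j0 J)"
  shows False
proof -
  let ?K = "insert j0 J"
  have ns: "nonsingular g {..<m} J"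
    using t(1) low by (subst nonsingular_cong[of _ _ g "gt t"]) auto
  obtain c where c: "\<forall>i\<in>{..<Suc m}. (\<Sum>j\<in>?K. gt t (i, j) * c j) = 0" "\<exists>j\<in>?K. c j \<noteq> 0"
    by (rule singularE[OF t(2)])
  obtain d where d: "\<forall>i\<in>{..<Suc m}. (\<Sum>j\<in>?K. gt s (i, j) * d j) = 0" "\<exists>j\<in>?K. d j \<noteq> 0"
    by (rule singularE[OF s])
  have clow: "(\<Sum>j\<in>?K. g (i, j) * c j) = 0" if "i < m" for i
  proof -
    have "(\<Sum>j\<in>?K. g (i, j) * c j) = (\<Sum>j\<in>?K. gt t (i, j) * c j)"
      using that by (intro sum.cong) (auto simp: low)
    then show ?thesis using c(1) that by simp
  qed
  have dlow: "(\<Sum>j\<in>?K. g (i, j) * d j) = 0" if "i < m" for i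
  proof -
    have "(\<Sum>j\<in>?K. g (i, j) * d j) = (\<Sum>j\<in>?K. gt s (i, j) * d j)"
      using that by (intro sum.cong) (auto simp: low)
    then show ?thesis using d(1) that by simp
  qed
  have sc: "(\<Sum>j\<in>?K. gt s (m, j) * c j) = 0"
    by (rule kernel_row_transfer[OF ns J _ _ d(2)]) (use clow dlow d(1) in auto)
  define x where "x = (\<Sum>j\<in>?K. g (m, j) * c j)"
  define y where "y = (\<Sum>j\<in>?K. g (l, j) * c j)"
  have rowm: "(\<Sum>j\<in>?K. gt r (m, j) * c j) = cos r * x + sin r * y" for r
  proof -
    have "(\<Sum>j\<in>?K. gt r (m, j) * c j) = (\<Sum>j\<in>?K. cos r * (g (m, j) * c j) + sin r * (g (l, j) * c j))"
      by (intro sum.cong) (simp_all only: rm, simp_all add: algebra_simps)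
    then show ?thesis by (simp only: x_def y_def sum.distrib sum_distrib_left)
  qed
  have 1: "cos t * x + sin t * y = 0" using c(1) rowm[of t] by simp
  have 2: "cos s * x + sin s * y = 0" using sc rowm[of s] by simp
  \<comment> \<open>Cramer's rule for the system in x and y, whose determinant is sin (s -
    t).\<close>
  have "sin (s - t) * x = sin s * (cos t * x + sin t * y) - sin t * (cos s * x + sin s * y)"
    by (simp add: sin_diff algebra_simps)
  then have x0: "x = 0" using 1 2 st by simp
  have "sin (s - t) * y = cos t * (cos s * x + sin s * y) - cos s * (cos t * x + sin t * y)"
    by (simp add: sin_diff algebra_simps)
  then have y0: "y = 0" using 1 2 st by simp
  have "(\<Sum>j\<in>?K. gt t (l, j) * c j) = (\<Sum>j\<in>?K. cos t * (g (l, j) * c j) - sin t * (g (m, j) * c j))"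
    by (intro sum.cong) (simp_all only: rl, simp_all add: algebra_simps)
  also have "\<dots> = cos t * y - sin t * x"
    by (simp only: x_def y_def sum_subtractf sum_distrib_left)
  finally have "\<forall>i\<in>insert l {..<m}. (\<Sum>j\<in>?K. gt t (i, j) * c j) = 0"
    using c(1) x0 y0 by auto
  then show False using t(3) c(2) unfolding nonsingular_def by blast
qed

section \<open>Transport of invariance to Borel events\<close>

lemma entries_measurable_borel:
  assumes "(\<lambda>\<omega>. entries N (U \<omega>)) \<in> M \<rightarrow>\<^sub>M borel_entries N"
  shows "(\<lambda>\<omega>. entries N (U \<omega>)) \<in> borel_measurable M"
proof (rule measurable_coordinatewise_then_product)
  fix p
  show "(\<lambda>\<omega>. entries N (U \<omega>) p) \<in> borel_measurable M"
  proof (cases "p \<in> {..<N} \<times> {..<N}")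
    case True
    then show ?thesis
      by (rule measurable_compose[OF assms measurable_component_singleton])
  next
    case False
    then have "(\<lambda>\<omega>. entries N (U \<omega>) p) = (\<lambda>\<omega>. undefined)"
      unfolding entries_def restrict_def by (auto split: prod.splits)
    then show ?thesis by simp
  qed
qed

lemma entries_apply: "i < N \<Longrightarrow> j < N \<Longrightarrow> entries N R (i, j) = R $$ (i, j)"
  by (simp add: entries_def)

text \<open>Invariance is given on the product of the N^2 entries, whereas the events are Borel sets
  of functions on all index pairs. Coordinates outside the square are the constant
  \<open>undefined\<close>, so the trace of E is measurable there.\<close>

lemma rotation_invariance:
  assumes unif: "uniform_random_rotation M N U" and R: "R \<in> rotations N" and E: "E \<in> sets borel"
  shows "measure M {\<omega> \<in> space M. entries N (R * U \<omega>) \<in> E} = measure M {\<omega> \<in> space M. entries N (U \<omega>) \<in> E}"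
    and "{\<omega> \<in> space M. entries N (R * U \<omega>) \<in> E} \<in> sets M"
proof -
  have U: "\<And>\<omega>. \<omega> \<in> space M \<Longrightarrow> U \<omega> \<in> carrier_mat N N"
    and mU: "(\<lambda>\<omega>. entries N (U \<omega>)) \<in> M \<rightarrow>\<^sub>M borel_entries N"
    and inv: "distr M (borel_entries N) (\<lambda>\<omega>. entries N (R * U \<omega>)) = distr M (borel_entries N) (\<lambda>\<omega>. entries N (U \<omega>))"
    using unif R by (auto simp: uniform_random_rotation_def rotations_def)
  have Rc: "R \<in> carrier_mat N N" using R by (simp add: rotations_def)
  have comp: "(\<lambda>\<omega>. U \<omega> $$ (k, j)) \<in> borel_measurable M" if "k < N" "j < N" for k j
  proof -
    have "(\<lambda>\<omega>. entries N (U \<omega>) (k, j)) \<in> borel_measurable M"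
      by (rule measurable_compose[OF mU measurable_component_singleton]) (use that in auto)
    then show ?thesis using that by (simp add: entries_apply)
  qed
  have mRU: "(\<lambda>\<omega>. entries N (R * U \<omega>)) \<in> M \<rightarrow>\<^sub>M borel_entries N"
    unfolding entries_def
  proof (rule measurable_restrict)
    fix p assume "p \<in> {..<N} \<times> {..<N}"
    then obtain i j where p: "p = (i, j)" "i < N" "j < N" by auto
    have "(\<lambda>\<omega>. \<Sum>k<N. R $$ (i, k) * U \<omega> $$ (k, j)) \<in> borel_measurable M"
      using p comp by (intro borel_measurable_sum borel_measurable_times borel_measurable_const) auto
    then show "(\<lambda>\<omega>. (R * U \<omega>) $$ p) \<in> borel_measurable M"
      using p U Rc by (subst measurable_cong[where g = "\<lambda>\<omega>. \<Sum>k<N. R $$ (i, k) * U \<omega> $$ (k, j)"])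
        (auto simp: mult_mat_entry simp del: index_mult_mat)
  qed
  have "(\<lambda>x. x) \<in> borel_measurable (borel_entries N)"
  proof (rule measurable_coordinatewise_then_product)
    fix p
    show "(\<lambda>x. x p) \<in> borel_measurable (borel_entries N)"
    proof (cases "p \<in> {..<N} \<times> {..<N}")
      case False
      then have "(\<lambda>x. x p) \<in> borel_measurable (borel_entries N) \<longleftrightarrow> (\<lambda>x. undefined :: real) \<in> borel_measurable (borel_entries N)"
        by (intro measurable_cong) (auto simp: space_PiM intro: PiE_arb)
      then show ?thesis by simp
    qed (rule measurable_component_singleton)
  qed
  then have E': "E \<inter> space (borel_entries N) \<in> sets (borel_entries N)"
    using measurable_sets[of "\<lambda>x. x" "borel_entries N" borel E] E by simp
  have pre: "f -` (E \<inter> space (borel_entries N)) \<inter> space M = {\<omega> \<in> space M. f \<omega> \<in> E}"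
    if "f \<in> M \<rightarrow>\<^sub>M borel_entries N" for f
    using measurable_space[OF that] by auto
  show "{\<omega> \<in> space M. entries N (R * U \<omega>) \<in> E} \<in> sets M"
    using measurable_sets[OF mRU E'] by (simp only: pre[OF mRU])
  show "measure M {\<omega> \<in> space M. entries N (R * U \<omega>) \<in> E} = measure M {\<omega> \<in> space M. entries N (U \<omega>) \<in> E}"
    using arg_cong[OF inv, of "\<lambda>D. measure D (E \<inter> space (borel_entries N))"]
    by (simp only: measure_distr[OF mRU E'] measure_distr[OF mU E'] pre[OF mRU] pre[OF mU])
qed

lemma borel_step_event:
  assumes "finite J"
  shows "{g. nonsingular g {..<m} J \<and> \<not> nonsingular g {..<Suc m} (insert j0 J) \<and>
      nonsingular g (insert l {..<m}) (insert j0 J)} \<in> sets borel"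
proof -
  have "{g. nonsingular g {..<m} J} \<inter> (- {g. nonsingular g {..<Suc m} (insert j0 J)} \<inter>
      {g. nonsingular g (insert l {..<m}) (insert j0 J)}) \<in> sets borel"
    using assms by (intro sets.Int borel_comp borel_nonsingular) auto
  then show ?thesis by (simp add: Int_def Compl_eq)
qed

text \<open>Mixing rows \<open>m\<close> and \<open>l\<close> by different angles moves the event to disjoint events of equal
  probability.\<close>

lemma step_event_null:
  assumes unif: "uniform_random_rotation M N U" and J: "insert j0 J \<subseteq> {..<N}" "j0 \<notin> J" and l: "m < l" "l < N"
  defines "E \<equiv> {g. nonsingular g {..<m} J \<and> \<not> nonsingular g {..<Suc m} (insert j0 J) \<and>
      nonsingular g (insert l {..<m}) (insert j0 J)}"
  shows "AE \<omega> in M. entries N (U \<omega>) \<notin> E"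
proof -
  interpret prob_space M using unif by (simp add: uniform_random_rotation_def)
  have finJ: "finite J" using J(1) by (auto intro: finite_subset)
  have E: "E \<in> sets borel" unfolding E_def by (rule borel_step_event[OF finJ])
  \<comment> \<open>Distinct angles in (0,1]: their differences lie strictly between -pi and pi and
    are nonzero, so their sines do not vanish.\<close>
  define t where "t i = 1 / (real i + 1)" for i :: nat
  define R where "R i = givens N m l (t i)" for i
  define F where "F i = {\<omega> \<in> space M. entries N (R i * U \<omega>) \<in> E}" for i
  have rot: "R i \<in> rotations N" for i
    unfolding R_def using l by (intro givens_in_rotations) auto
  have prob: "prob (F i) = prob {\<omega> \<in> space M. entries N (U \<omega>) \<in> E}" and meas: "F i \<in> events" for i
    using rotation_invariance[OF unif rot E] by (simp_all add: F_def)
  have "disjoint_family F"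
    unfolding disjoint_family_on_def
  proof (intro ballI impI)
    fix i k :: nat assume "i \<noteq> k"
    show "F i \<inter> F k = {}"
    proof (rule ccontr)
      assume "F i \<inter> F k \<noteq> {}"
      then obtain \<omega> where \<omega>: "\<omega> \<in> space M" "entries N (R i * U \<omega>) \<in> E" "entries N (R k * U \<omega>) \<in> E"
        by (auto simp: F_def)
      define g where "g = entries N (U \<omega>)"
      define gt where "gt s = entries N (givens N m l s * U \<omega>)" for s
      have U: "U \<omega> \<in> carrier_mat N N"
        using unif \<omega>(1) by (auto simp: uniform_random_rotation_def rotations_def)
      have gt: "gt s (i, j) = (if i = m then cos s * g (m, j) + sin s * g (l, j)
          else if i = l then cos s * g (l, j) - sin s * g (m, j) else g (i, j))" if "i < N" "j < N" for s i j
      proof -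
        have "gt s (i, j) = (\<Sum>k<N. givens N m l s $$ (i, k) * U \<omega> $$ (k, j))"
          using that U by (simp add: gt_def entries_apply mult_mat_entry del: index_mult_mat)
        also have "\<dots> = (if i = m then cos s * g (m, j) + sin s * g (l, j)
          else if i = l then cos s * g (l, j) - sin s * g (m, j) else g (i, j))"
          using that l by (subst givens_row) (auto simp: g_def entries_apply)
        finally show ?thesis .
      qed
      have lt: "j < N" if "j \<in> insert j0 J" for j using J that by auto
      have "sin (t k - t i) \<noteq> 0"
      proof -
        have "t k \<noteq> t i" using \<open>i \<noteq> k\<close> by (simp add: t_def)
        moreover have "0 < t r" "t r \<le> 1" for r by (auto simp: t_def)
        from this[of i] this[of k] have "- pi < t k - t i" "t k - t i < pi"
          using pi_gt3 by linarith+
        ultimately show ?thesis using sin_eq_0_pi by force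
      qed
      then show False
        using \<omega>(2,3) l lt
        by (intro rotated_rows_exclusive[of J j0 m l gt g "t k" "t i"])
           (auto simp: finJ J(2) gt E_def R_def gt_def[symmetric])
    qed
  qed
  then have "(\<lambda>i. prob (F i)) sums prob (\<Union>i. F i)"
    using meas by (intro finite_measure_UNION) auto
  \<comment> \<open>The probabilities of the disjoint events form a constant sequence, and a
    summable constant is 0.\<close>
  then have "summable (\<lambda>i::nat. prob {\<omega> \<in> space M. entries N (U \<omega>) \<in> E})"
    unfolding prob by (rule sums_summable)
  then have "prob {\<omega> \<in> space M. entries N (U \<omega>) \<in> E} = 0"
    by (simp add: summable_const_iff)
  moreover have mU: "(\<lambda>\<omega>. entries N (U \<omega>)) \<in> borel_measurable M"
    using unif by (intro entries_measurable_borel) (simp add: uniform_random_rotation_def)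
  have "{\<omega> \<in> space M. entries N (U \<omega>) \<in> E} \<in> events"
    using measurable_sets[OF mU E] by (simp add: vimage_def Int_def conj_commute)
  ultimately have "AE \<omega> in M. \<omega> \<notin> {\<omega> \<in> space M. entries N (U \<omega>) \<in> E}"
    by (simp add: prob_eq_0)
  then show ?thesis by (rule AE_mp) (auto intro!: AE_I2)
qed

text \<open>If no later row repaired the minor, its kernel vector c would be annihilated by every
  row of U: each later row, together with the first m, has some kernel vector, which is proportional
  to c. Padding c with zeros then contradicts invertibility.\<close>

lemma rotation_extends_nonsingular:
  assumes U: "U \<in> rotations N" and J: "insert j0 J \<subseteq> {..<N}" "j0 \<notin> J"
    and ns: "nonsingular (entries N U) {..<m} J"
    and sing: "\<not> nonsingular (entries N U) {..<Suc m} (insert j0 J)" and "m < N"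
  shows "\<exists>l\<in>{m<..<N}. nonsingular (entries N U) (insert l {..<m}) (insert j0 J)"
proof (rule ccontr)
  assume "\<not> (\<exists>l\<in>{m<..<N}. nonsingular (entries N U) (insert l {..<m}) (insert j0 J))"
  then have all: "\<not> nonsingular (entries N U) (insert l {..<m}) (insert j0 J)" if "m < l" "l < N" for l
    using that by simp
  let ?K = "insert j0 J" and ?g = "entries N U"
  have finJ: "finite J" using J(1) by (auto intro: finite_subset)
  obtain c where c: "\<forall>i\<in>{..<Suc m}. (\<Sum>j\<in>?K. ?g (i, j) * c j) = 0" "\<exists>j\<in>?K. c j \<noteq> 0"
    by (rule singularE[OF sing])
  have rows: "(\<Sum>j\<in>?K. ?g (i, j) * c j) = 0" if "i < N" for i
  proof (cases "i < Suc m")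
    case False
    then have "\<not> nonsingular ?g (insert i {..<m}) ?K"
      using all[of i] \<open>i < N\<close> by simp
    then obtain d where d: "\<forall>r\<in>insert i {..<m}. (\<Sum>j\<in>?K. ?g (r, j) * d j) = 0" "\<exists>j\<in>?K. d j \<noteq> 0"
      by (rule singularE)
    show ?thesis
      by (rule kernel_row_transfer[OF ns finJ J(2) _ _ d(2)]) (use c(1) d(1) in auto)
  qed (use c(1) in simp)
  define e where "e j = (if j \<in> ?K then c j else 0)" for j
  have "(\<Sum>j<N. U $$ (i, j) * e j) = 0" if "i < N" for i
  proof -
    have "(\<Sum>j<N. U $$ (i, j) * e j) = (\<Sum>j\<in>?K. ?g (i, j) * c j)"
      using J that by (intro sum.mono_neutral_cong_right) (auto simp: e_def entries_apply)
    then show ?thesis using rows[OF that] by simp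
  qed
  then have "e k = 0" if "k < N" for k using rotation_kernel[OF U, of e] that by blast
  then have "c j = 0" if "j \<in> ?K" for j
    using that J(1) by (metis e_def lessThan_iff subsetD)
  then show False using c(2) by blast
qed

text \<open>Columns are added one at a time, together with the next row. A first failure has a
  repairing row l, so it falls into one of finitely many null events.\<close>

lemma AE_nonsingular:
  assumes unif: "uniform_random_rotation M N U" and J: "J \<subseteq> {..<N}"
  shows "AE \<omega> in M. nonsingular (entries N (U \<omega>)) {..<card J} J"
proof -
  have "finite J" using J by (rule finite_subset) simp
  then show ?thesis using J
  proof (induction J)
    case empty
    then show ?case by (simp add: nonsingular_def)
  next
    case (insert j0 J)
    let ?m = "card J"
    have "?m < N"
      using card_mono[OF _ insert.prems] insert.hyps by simp
    define E where "E l = {g. nonsingular g {..<?m} J \<and> \<not> nonsingular g {..<Suc ?m} (insert j0 J) \<and>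
        nonsingular g (insert l {..<?m}) (insert j0 J)}" for l
    have "AE \<omega> in M. \<forall>l\<in>{?m<..<N}. entries N (U \<omega>) \<notin> E l"
      unfolding E_def using insert.hyps insert.prems
      by (intro AE_finite_allI step_event_null[OF unif]) auto
    moreover have "AE \<omega> in M. nonsingular (entries N (U \<omega>)) {..<?m} J"
      using insert by simp
    moreover have "AE \<omega> in M. U \<omega> \<in> rotations N"
      using unif by (intro AE_I2) (simp add: uniform_random_rotation_def)
    ultimately have "AE \<omega> in M. nonsingular (entries N (U \<omega>)) {..<Suc ?m} (insert j0 J)"
    proof eventually_elim
      case (elim \<omega>)
      show ?case
      proof (rule ccontr)
        assume sing: "\<not> ?thesis"
        then obtain l where "l \<in> {?m<..<N}" "nonsingular (entries N (U \<omega>)) (insert l {..<?m}) (insert j0 J)"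
          using rotation_extends_nonsingular[OF elim(3) insert.prems insert.hyps(2) elim(2) sing \<open>?m < N\<close>] by blast
        then show False using elim(1,2) sing by (auto simp: E_def)
      qed
    qed
    then show ?case using insert.hyps by simp
  qed
qed

section \<open>The phase transition\<close>

lemma expected_num_faces:
  assumes proj: "uniform_random_projection M n N A" and k: "k < n" and n: "n < N"
  shows "(\<integral>\<omega>. real (num_faces k (mat_map (A \<omega>) ` hypercube N)) \<partial>M) / real (num_faces k (hypercube N))
    = 1 - (\<Sum>l<N - n. real (N - k - 1 choose l)) / 2 ^ (N - k - 1)"
proof -
  obtain U where unif: "uniform_random_rotation M N U"
      and A: "\<And>\<omega>. \<omega> \<in> space M \<Longrightarrow> A \<omega> = first_coords n N * U \<omega>"
    using proj by (auto simp: uniform_random_projection_def)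
  interpret prob_space M using unif by (simp add: uniform_random_rotation_def)
  have U: "U \<omega> \<in> carrier_mat N N" if "\<omega> \<in> space M" for \<omega>
    using unif that by (auto simp: uniform_random_rotation_def rotations_def)
  have dims: "dim_row (A \<omega>) = n \<and> dim_col (A \<omega>) = N" if "\<omega> \<in> space M" for \<omega>
    using A[OF that] U[OF that] by (simp add: first_coords_def)
  have entry: "A \<omega> $$ (i, j) = entries N (U \<omega>) (i, j)" if "\<omega> \<in> space M" "i < n" "j < N" for \<omega> i j
  proof -
    have "A \<omega> $$ (i, j) = (\<Sum>k<N. (if i = k then 1 else 0) * U \<omega> $$ (k, j))"
      using A[OF that(1)] U[OF that(1)] that n
      by (auto simp: first_coords_def scalar_prod_def lessThan_atLeast0 intro!: sum.cong)
    also have "\<dots> = (\<Sum>k<N. if k = i then U \<omega> $$ (i, j) else 0)"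
      by (intro sum.cong) auto
    finally show ?thesis using that n by (simp add: entries_apply)
  qed
  define c where "c = (N choose k) * (2 ^ (N - k) - chambers (N - k) (N - n))"
  have meas: "(\<lambda>\<omega>. real (num_faces k (mat_map (A \<omega>) ` hypercube N))) \<in> borel_measurable M"
    using unif dims entry
    by (intro measurable_num_faces[of "\<lambda>\<omega>. entries N (U \<omega>)"] entries_measurable_borel)
       (auto simp: uniform_random_rotation_def)
  have "AE \<omega> in M. \<forall>J\<in>{J. J \<subseteq> {..<N} \<and> card J = n}. nonsingular (entries N (U \<omega>)) {..<n} J"
  proof (rule AE_finite_allI)
    show "finite {J. J \<subseteq> {..<N} \<and> card J = n}"
      by (rule finite_subset[of _ "Pow {..<N}"]) auto
    fix J assume "J \<in> {J. J \<subseteq> {..<N} \<and> card J = n}"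
    then show "AE \<omega> in M. nonsingular (entries N (U \<omega>)) {..<n} J"
      using AE_nonsingular[OF unif, of J] by simp
  qed
  then have "AE \<omega> in M. real (num_faces k (mat_map (A \<omega>) ` hypercube N)) = real c"
  proof (rule AE_mp, intro AE_I2 impI)
    fix \<omega> assume \<omega>: "\<omega> \<in> space M"
      and ns: "\<forall>J\<in>{J. J \<subseteq> {..<N} \<and> card J = n}. nonsingular (entries N (U \<omega>)) {..<n} J"
    have "indep_columns (A \<omega>) J" if "J \<subseteq> {..<N}" "card J = n" for J
      using indep_columns_iff_nonsingular[of "A \<omega>" n N J "entries N (U \<omega>)"] dims[OF \<omega>] entry[OF \<omega>] ns that
      by simp
    then have "num_faces k (mat_map (A \<omega>) ` hypercube N) = c"
      unfolding c_def using dims[OF \<omega>] k n by (intro num_faces_generic_projection) auto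
    then show "real (num_faces k (mat_map (A \<omega>) ` hypercube N)) = real c" by simp
  qed
  then have "(\<integral>\<omega>. real (num_faces k (mat_map (A \<omega>) ` hypercube N)) \<partial>M) = (\<integral>\<omega>. real c \<partial>M)"
    using meas by (intro integral_cong_AE) auto
  then have int: "(\<integral>\<omega>. real (num_faces k (mat_map (A \<omega>) ` hypercube N)) \<partial>M) = real c"
    by (simp add: prob_space)
  \<comment> \<open>k < n < N makes N - k a successor, as \<open>chambers_eq_sum\<close> requires,
    and N - n at most L + 1, so the subtraction in c is not truncated.\<close>
  define L where "L = N - k - 1"
  have NL: "N - k = Suc L" using k n by (simp add: L_def)
  define s where "s = (\<Sum>l<N - n. L choose l)"
  have "N - n \<le> Suc L" using k by (simp add: L_def)
  then have "s \<le> (\<Sum>l\<le>L. L choose l)"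
    unfolding s_def by (intro sum_mono2) auto
  then have sle: "2 * s \<le> 2 ^ Suc L" by (simp add: choose_row_sum)
  have ch: "N choose k > 0" using k n by simp
  have "real c / real (num_faces k (hypercube N)) = (2 ^ Suc L - 2 * real s) / 2 ^ Suc L"
    unfolding c_def num_faces_hypercube NL chambers_eq_sum s_def[symmetric]
    using ch sle by (simp add: of_nat_diff)
  also have "\<dots> = 1 - real s / 2 ^ L"
    by (simp add: field_simps)
  finally show ?thesis
    unfolding int by (simp add: s_def L_def)
qed

theorem theorem1p1:
  fixes \<rho> \<delta> :: real
    and k N :: "nat \<Rightarrow> nat"
    and M :: "nat \<Rightarrow> 'w measure"
    and A :: "nat \<Rightarrow> 'w \<Rightarrow> real mat"
  assumes "0 < \<rho>" "\<rho> < 1" "0 < \<delta>" "\<delta> < 1"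
    and "\<And>n. 0 < n \<Longrightarrow> k n < n \<and> n < N n"
    and "(\<lambda>n. real (k n) / real n) \<longlonglongrightarrow> \<rho>"
    and "(\<lambda>n. real n / real (N n)) \<longlonglongrightarrow> \<delta>"
    and "\<And>n. 0 < n \<Longrightarrow> uniform_random_projection (M n) n (N n) (A n)"
  shows "(\<rho> < rho_W_cube \<delta> \<longrightarrow>
            (\<lambda>n. (\<integral>\<omega>. real (num_faces (k n) (mat_map (A n \<omega>) ` hypercube (N n))) \<partial>M n)
                   / real (num_faces (k n) (hypercube (N n)))) \<longlonglongrightarrow> 1) \<and>
         (\<rho> > rho_W_cube \<delta> \<longrightarrow>
            (\<lambda>n. (\<integral>\<omega>. real (num_faces (k n) (mat_map (A n \<omega>) ` hypercube (N n))) \<partial>M n)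
                   / real (num_faces (k n) (hypercube (N n)))) \<longlonglongrightarrow> 0)"
proof -
  define m t where "m n = N n - k n - 1" and "t n = N n - n" for n
  let ?E = "\<lambda>n. (\<integral>\<omega>. real (num_faces (k n) (mat_map (A n \<omega>) ` hypercube (N n))) \<partial>M n)
                   / real (num_faces (k n) (hypercube (N n)))"
  let ?P = "\<lambda>n. (\<Sum>l<t n. real (m n choose l)) / 2 ^ m n"
  have E: "\<forall>\<^sub>F n in sequentially. 1 - ?P n = ?E n"
    using eventually_gt_at_top[of 0]
  proof eventually_elim
    case (elim n)
    then show ?case
      using expected_num_faces[OF assms(8)[OF elim], of "k n"] assms(5)[OF elim] by (simp add: m_def t_def)
  qed
  have le: "\<forall>\<^sub>F n in sequentially. t n \<le> m n"
    using eventually_gt_at_top[of 0]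
  proof eventually_elim
    case (elim n)
    then show ?case using assms(5)[OF elim] unfolding m_def t_def by linarith
  qed
  have \<rho>\<delta>: "\<rho> * \<delta> < 1" using mult_strict_mono[OF assms(2,4)] assms(3) by simp
  \<comment> \<open>The limit of t/m: numerator and denominator are divided by N, and k/N is written
    as (k/n)(n/N). The final -1 in m becomes (1/n)(n/N), which tends to 0.\<close>
  define \<beta> where "\<beta> = (1 - \<delta>) / (1 - \<rho> * \<delta>)"
  have "(\<lambda>n. (1 - real n / real (N n)) / (1 - real (k n) / real n * (real n / real (N n)) - 1 / real n * (real n / real (N n))))
      \<longlonglongrightarrow> (1 - \<delta>) / (1 - \<rho> * \<delta> - 0 * \<delta>)"
    using \<rho>\<delta> by (intro tendsto_divide tendsto_diff tendsto_mult tendsto_const assms(6,7) lim_1_over_n) simp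
  moreover have "\<forall>\<^sub>F n in sequentially.
      (1 - real n / real (N n)) / (1 - real (k n) / real n * (real n / real (N n)) - 1 / real n * (real n / real (N n)))
      = real (t n) / real (m n)"
    using eventually_gt_at_top[of 0]
  proof eventually_elim
    case (elim n)
    then have kn: "k n < n" "n < N n" using assms(5) by auto
    have "real (m n) = real (N n) - real (k n) - 1" "real (t n) = real (N n) - real n"
      using kn by (simp_all add: m_def t_def of_nat_diff)
    moreover have "(1 - real n / real (N n)) = (real (N n) - real n) / real (N n)"
      using kn by (simp add: field_simps)
    moreover have "1 - real (k n) / real n * (real n / real (N n)) - 1 / real n * (real n / real (N n))
        = (real (N n) - real (k n) - 1) / real (N n)"
      using kn elim by (simp add: field_simps)
    ultimately show ?case using kn by simp
  qed
  ultimately have lim: "(\<lambda>n. real (t n) / real (m n)) \<longlonglongrightarrow> \<beta>"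
    by (simp add: \<beta>_def tendsto_cong)
  have "filterlim m at_top sequentially"
  proof (rule filterlim_at_top_mono)
    show "filterlim t at_top sequentially"
    proof -
      \<comment> \<open>t = (N/n - 1) n, and the first factor tends to 1/\<delta> - 1 > 0.\<close>
      have "filterlim (\<lambda>n. (inverse (real n / real (N n)) - 1) * real n) at_top sequentially"
        using assms(3,4)
        by (intro filterlim_tendsto_pos_mult_at_top[OF tendsto_diff[OF tendsto_inverse[OF assms(7)] tendsto_const[of 1]]]
              filterlim_real_sequentially) (auto simp: one_less_inverse_iff)
      moreover have "\<forall>\<^sub>F n in sequentially. (inverse (real n / real (N n)) - 1) * real n = real (t n)"
        using eventually_gt_at_top[of 0]
      proof eventually_elim
        case (elim n)
        then show ?case using assms(5)[OF elim] by (simp add: t_def of_nat_diff field_simps)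
      qed
      ultimately have "filterlim (\<lambda>n. real (t n)) at_top sequentially"
        by (simp add: filterlim_cong)
      then show ?thesis by (simp add: filterlim_sequentially_iff_filterlim_real)
    qed
  qed (rule le)
  note m_top = this
  have thr: "\<beta> < 1/2 \<longleftrightarrow> \<rho> < 2 - inverse \<delta>" "1/2 < \<beta> \<longleftrightarrow> 2 - inverse \<delta> < \<rho>"
  proof -
    \<comment> \<open>Clearing the positive denominator, \<beta> < 1/2 reads 2 - 2\<delta> < 1 -
      \<rho>\<delta>; dividing by \<delta> gives the threshold.\<close>
    have "\<beta> < 1/2 \<longleftrightarrow> \<rho> * \<delta> < 2 * \<delta> - 1" "1/2 < \<beta> \<longleftrightarrow> 2 * \<delta> - 1 < \<rho> * \<delta>"
      using \<rho>\<delta> by (auto simp: \<beta>_def pos_divide_less_eq pos_less_divide_eq)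
    moreover have "2 * \<delta> - 1 = (2 - inverse \<delta>) * \<delta>"
      using assms(3) by (simp add: left_diff_distrib)
    ultimately show "\<beta> < 1/2 \<longleftrightarrow> \<rho> < 2 - inverse \<delta>" "1/2 < \<beta> \<longleftrightarrow> 2 - inverse \<delta> < \<rho>"
      using assms(3) by simp_all
  qed
  show ?thesis
  proof (intro conjI impI)
    assume "\<rho> < rho_W_cube \<delta>"
    \<comment> \<open>As \<rho> > 0, lying below the maximum means lying below 2 -
      1/\<delta>.\<close>
    then have "\<beta> < 1/2" using thr(1) assms(1) by (simp add: rho_W_cube_def)
    then have "(\<lambda>n. 1 - ?P n) \<longlonglongrightarrow> 1 - 0"
      by (intro tendsto_diff tendsto_const sum_choose_below_tendsto_0[OF m_top lim])
    then show "?E \<longlonglongrightarrow> 1" by (simp add: tendsto_cong[OF E])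
  next
    assume "\<rho> > rho_W_cube \<delta>"
    then have "1/2 < \<beta>" using thr(2) by (simp add: rho_W_cube_def)
    then have "(\<lambda>n. 1 - ?P n) \<longlonglongrightarrow> 1 - 1"
      by (intro tendsto_diff tendsto_const sum_choose_below_tendsto_1[OF m_top lim _ le])
    then show "?E \<longlonglongrightarrow> 0" by (simp add: tendsto_cong[OF E])
  qed
qed

end
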